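(* In the Bayesian linear Gaussian model $\mathbf{Y}=\widetilde{\mathbf{X}}\mathbf{H}+\mathbf{V}$ described in the context, with prior hyperparameter matrix $\mathbf{\Psi}=\mathrm{diag}[\psi_1,\dots,\psi_{NMR}]$, $\psi_i>0$, and white noise of variance $\sigma^2>0$, every unbiased estimator $\widehat{\mathbf{H}}=\widehat{\mathbf{H}}(\mathbf{Y})\in\mathbb{C}^{NMR\times K}$ of $\mathbf{H}$ satisfies the Bayesian Cramér–Rao bound $$\mathbb{E}\left[\left\|\widehat{\mathbf{H}}-\mathbf{H}\right\|_F^2\right]\ \ge\ \mathrm{Tr}\left[\left(\sigma^{-2}\left(\widetilde{\mathbf{X}}^H\widetilde{\mathbf{X}}\right)\otimes\mathbf{I}_K+\mathbf{\Psi}^{-1}\otimes\mathbf{I}_K\right)^{-1}\right],$$ where the expectation is over the joint distribution of $(\mathbf{Y},\mathbf{H})$.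
   Context: $N,M,R,K,L$ are positive integers (numbers of transmit antennas, receive antennas, range bins, pulses, and transmit samples). For each $n=1,\dots,N$, given complex numbers $x_n[1],\dots,x_n[L]$, $\mathbf{X}_n\in\mathbb{C}^{(L+R-1)\times R}$ is the Toeplitz convolution matrix with $(a,b)$ entry $x_n[a-b+1]$ when $1\le a-b+1\le L$ and $0$ otherwise. $\mathbf{X}=[\mathbf{X}_1,\dots,\mathbf{X}_N]\in\mathbb{C}^{(L+R-1)\times NR}$ and $\widetilde{\mathbf{X}}=\mathbf{I}_M\otimes\mathbf{X}\in\mathbb{C}^{M(L+R-1)\times NMR}$. Observation model: $\mathbf{Y}=\widetilde{\mathbf{X}}\mathbf{H}+\mathbf{V}$, where the entries of $\mathbf{V}\in\mathbb{C}^{M(L+R-1)\times K}$ are i.i.d. circularly symmetric complex Gaussian $\mathcal{CN}(0,\sigma^2)$, independent of $\mathbf{H}$. Prior: the entries of $\mathbf{H}\in\mathbb{C}^{NMR\times K}$ are independent with $\mathbf{H}(i,k)\sim\mathcal{CN}(0,\psi_i)$, i.e. $\mathbf{H}$ has density $$p(\mathbf{H};\mathbf{\Psi})=\prod_{i=1}^{NMR}\prod_{k=1}^{K}(\pi\psi_i)^{-1}\exp\left(-\frac{|\mathbf{H}(i,k)|^2}{\psi_i}\right),$$ where $\mathbf{\Psi}$ is fixed. An estimator is a measurable function $\widehat{\mathbf{H}}(\mathbf{Y})$ of the observation with finite second moment; unbiased is understood in the Bayesian sense $\mathbb{E}[\widehat{\mathbf{H}}-\mathbf{H}]=\mathbf{0}$,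 the expectation being over the joint distribution of $(\mathbf{Y},\mathbf{H})$. $\|\cdot\|_F$ is the Frobenius norm, $\mathrm{Tr}$ the trace, and $\otimes$ the Kronecker product. *)

theory Defs
  imports
    "HOL-Probability.Probability"
    "Jordan_Normal_Form.Gauss_Jordan_Elimination"
    "Jordan_Normal_Form.Schur_Decomposition"
begin

text \<open>Matrices are those of \<^theory>\<open>Jordan_Normal_Form.Matrix\<close>, so every row, column, antenna and sample
  index starts at 0. In particular \<open>x n l\<close> is the sample usually written $x_{n+1}[l+1]$ and
  \<open>\<psi> i\<close> the variance usually written $\psi_{i+1}$. The order on the complex numbers is the one of
  \<open>HOL-Library.Complex_Order\<close>: \<open>a \<le> b\<close> means \<open>Re a \<le> Re b \<and> Im a = Im b\<close>.\<close>

definition kronecker :: "'a::times mat \<Rightarrow> 'a mat \<Rightarrow> 'a mat" (infixl "\<otimes>\<^sub>m" 70) where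
  "A \<otimes>\<^sub>m B = mat (dim_row A * dim_row B) (dim_col A * dim_col B)
     (\<lambda>(i, j). A $$ (i div dim_row B, j div dim_col B) * B $$ (i mod dim_row B, j mod dim_col B))"

definition mat_trace :: "'a::comm_monoid_add mat \<Rightarrow> 'a" where
  "mat_trace A = (\<Sum>i<dim_row A. A $$ (i, i))"

definition frobenius_norm :: "complex mat \<Rightarrow> real" where
  "frobenius_norm A = sqrt (\<Sum>i<dim_row A. \<Sum>j<dim_col A. (cmod (A $$ (i, j)))\<^sup>2)"

text \<open>\<^const>\<open>mat_inverse\<close> returns \<open>None\<close> exactly on singular arguments; the value of \<open>inv_mat\<close>
  is meaningful only for invertible matrices.\<close>

definition inv_mat :: "'a::field mat \<Rightarrow> 'a mat" where
  "inv_mat A = the (mat_inverse A)"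

lemma inv_mat_eqI:
  fixes A :: "'a::field mat"
  assumes "A \<in> carrier_mat n n" "B \<in> carrier_mat n n" "A * B = 1\<^sub>m n" "B * A = 1\<^sub>m n"
  shows "inv_mat A = B"
proof (cases "mat_inverse A")
  case None
  from mat_inverse(1)[OF assms(1) None, of "()"] assms show ?thesis
    by (auto simp: Units_def ring_mat_def)
next
  case (Some C)
  note C = mat_inverse(2)[OF assms(1) Some]
  have "C = C * (A * B)" using C assms(3) by (metis right_mult_one_mat)
  also have "\<dots> = (C * A) * B" using C assms by (metis assoc_mult_mat)
  also have "\<dots> = B" using C assms(2) by (metis left_mult_one_mat)
  finally show ?thesis by (simp add: inv_mat_def Some)
qed

text \<open>Offsetting indices to start at 1, the guard reads $1 \le a - b + 1 \le L$ and the sample is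
  $x[a - b + 1]$.\<close>

definition toeplitz_conv :: "nat \<Rightarrow> nat \<Rightarrow> (nat \<Rightarrow> complex) \<Rightarrow> complex mat" where
  "toeplitz_conv L R x = mat (L + R - 1) R (\<lambda>(a, b). if b \<le> a \<and> a - b < L then x (a - b) else 0)"

text \<open>The block row $[X_1, \dots, X_N]$: column \<open>c\<close> is column \<open>c mod R\<close> of block \<open>c div R\<close>.\<close>

definition transmit_mat :: "nat \<Rightarrow> nat \<Rightarrow> nat \<Rightarrow> (nat \<Rightarrow> nat \<Rightarrow> complex) \<Rightarrow> complex mat" where
  "transmit_mat N R L x = mat (L + R - 1) (N * R)
     (\<lambda>(a, c). toeplitz_conv L R (x (c div R)) $$ (a, c mod R))"

definition observation_mat :: "nat \<Rightarrow> nat \<Rightarrow> nat \<Rightarrow> nat \<Rightarrow> (nat \<Rightarrow> nat \<Rightarrow> complex) \<Rightarrow> complex mat" where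
  "observation_mat N M R L x = 1\<^sub>m M \<otimes>\<^sub>m transmit_mat N R L x"

text \<open>The Borel \<open>\<sigma>\<close>-algebra on complex \<open>m \<times> n\<close> matrices.\<close>

definition mat_borel :: "nat \<Rightarrow> nat \<Rightarrow> complex mat measure" where
  "mat_borel m n = vimage_algebra (carrier_mat m n) (\<lambda>A. \<lambda>p\<in>{..<m} \<times> {..<n}. A $$ p)
     (\<Pi>\<^sub>M p\<in>{..<m} \<times> {..<n}. (borel :: complex measure))"

lemma space_mat_borel [simp]: "space (mat_borel m n) = carrier_mat m n"
  by (simp add: mat_borel_def)

lemma measurable_mat_borel_iff:
  "f \<in> measurable P (mat_borel m n) \<longleftrightarrow>
     f \<in> space P \<rightarrow> carrier_mat m n \<and>
     (\<forall>i<m. \<forall>j<n. (\<lambda>w. f w $$ (i, j)) \<in> borel_measurable P)" (is "?l \<longleftrightarrow> ?r")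
proof
  let ?g = "\<lambda>A::complex mat. \<lambda>p\<in>{..<m} \<times> {..<n}. A $$ p"
  let ?B = "\<Pi>\<^sub>M p\<in>{..<m} \<times> {..<n}. (borel :: complex measure)"
  have g: "?g \<in> measurable (mat_borel m n) ?B"
    unfolding mat_borel_def by (rule measurable_vimage_algebra1) (auto simp: space_PiM)
  {
    assume f: ?l
    have "(\<lambda>w. f w $$ (i, j)) \<in> borel_measurable P" if "i < m" "j < n" for i j
    proof -
      have "(\<lambda>w. ?g (f w) (i, j)) \<in> borel_measurable P"
        using measurable_compose[OF measurable_compose[OF f g] measurable_component_singleton] that
        by simp
      then show ?thesis using that by simp
    qed
    with measurable_space[OF f] show ?r by auto
  next
    assume f: ?r
    show ?l unfolding mat_borel_def
    proof (rule measurable_vimage_algebra2)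
      show "f \<in> space P \<rightarrow> carrier_mat m n" using f by blast
      show "(\<lambda>w. ?g (f w)) \<in> measurable P ?B"
        by (rule measurable_restrict) (use f in auto)
    qed
  }
qed

definition mat_expectation :: "'w measure \<Rightarrow> nat \<Rightarrow> nat \<Rightarrow> ('w \<Rightarrow> complex mat) \<Rightarrow> complex mat" where
  "mat_expectation P m n A = mat m n (\<lambda>(i, j). \<integral>w. A w $$ (i, j) \<partial>P)"

text \<open>Density of $\mathcal{CN}(0, v)$ with respect to Lebesgue measure on the complex plane.\<close>

definition cn_density :: "real \<Rightarrow> complex \<Rightarrow> real" where
  "cn_density v z = exp (- (cmod z)\<^sup>2 / v) / (pi * v)"

text \<open>\<open>A\<close> is a random \<open>m \<times> n\<close> matrix with independent entries, those of row \<open>i\<close> having law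
  $\mathcal{CN}(0, v_i)$.\<close>

definition indep_cn_entries ::
  "'w measure \<Rightarrow> nat \<Rightarrow> nat \<Rightarrow> (nat \<Rightarrow> real) \<Rightarrow> ('w \<Rightarrow> complex mat) \<Rightarrow> bool" where
  "indep_cn_entries P m n v A \<longleftrightarrow>
     A \<in> measurable P (mat_borel m n) \<and>
     prob_space.indep_vars P (\<lambda>_. borel) (\<lambda>p w. A w $$ p) ({..<m} \<times> {..<n}) \<and>
     (\<forall>i<m. \<forall>j<n. distributed P lborel (\<lambda>w. A w $$ (i, j)) (\<lambda>z. ennreal (cn_density (v i) z)))"

end

theory Submission
  imports Defs
begin

text \<open>Let $S = X^H \Sigma^{-1} V - \Psi^{-1} H$ be the score in \<open>H\<close> of the joint law of
  \<open>(Y, H)\<close>, where $\Sigma$ is the noise covariance.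
  Shifting \<open>H\<close> by \<open>t U\<close> and \<open>V\<close> by \<open>- t X U\<close> leaves \<open>Y = X H + V\<close> unchanged and multiplies the
  density by $\exp(2 t s - t^2 c)$ with $s = \mathrm{Re}\,\langle U, S\rangle$. Hence
  $E[G(Y)] = E[G(Y) \exp(2 t s - t^2 c)]$ for all \<open>t\<close>, which forces $E[G(Y) s] = 0$: the score is
  orthogonal to every integrable function of \<open>Y\<close>. With \<open>B\<close> the Bayesian information matrix and \<open>C\<close> its
  inverse, $C S = W Y - H$ for a suitable \<open>W\<close>, so the error \<open>e\<close> of this linear estimator is orthogonal
  to all functions of \<open>Y\<close>, and $E|e_{ik}|^2 = C_{ii}$. For any other error \<open>d\<close>,
  $|d|^2 \ge 2\,\mathrm{Re}(d \bar e) - |e|^2$ entrywise, and $E[d \bar e] = E|e|^2$.\<close>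

subsection \<open>Kronecker products with an identity factor\<close>

lemma sum_lessThan_mult:
  fixes f :: "nat \<Rightarrow> 'a::comm_monoid_add"
  shows "(\<Sum>j<n * K. f j) = (\<Sum>a<n. \<Sum>b<K. f (a * K + b))"
  unfolding sum.nat_group[symmetric]
proof (rule sum.cong)
  fix a
  show "sum f {a * K..<a * K + K} = (\<Sum>b<K. f (a * K + b))"
    using sum.shift_bounds_nat_ivl[of f 0 "a * K" K] by (simp add: atLeast0LessThan add.commute)
qed simp

lemma kronecker_one_carrier: "A \<in> carrier_mat n n \<Longrightarrow> A \<otimes>\<^sub>m 1\<^sub>m K \<in> carrier_mat (n * K) (n * K)"
  by (auto simp: kronecker_def)

lemma kronecker_one_index:
  assumes "A \<in> carrier_mat n n" "i < n * K" "j < n * K"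
  shows "(A \<otimes>\<^sub>m 1\<^sub>m K) $$ (i, j) = A $$ (i div K, j div K) * (if i mod K = j mod K then 1 else 0)"
  using assms by (cases "K = 0") (auto simp: kronecker_def)

lemma kronecker_one_mult:
  fixes A B :: "'a::comm_ring_1 mat"
  assumes A: "A \<in> carrier_mat n n" and B: "B \<in> carrier_mat n n"
  shows "(A \<otimes>\<^sub>m 1\<^sub>m K) * (B \<otimes>\<^sub>m 1\<^sub>m K) = (A * B) \<otimes>\<^sub>m 1\<^sub>m K"
proof (rule eq_matI)
  fix i j assume "i < dim_row ((A * B) \<otimes>\<^sub>m 1\<^sub>m K)" "j < dim_col ((A * B) \<otimes>\<^sub>m 1\<^sub>m K)"
  then have ij: "i < n * K" "j < n * K" using A B by (auto simp: kronecker_def)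
  then have K: "K > 0" by (cases K) auto
  have div: "i div K < n" "j div K < n" using ij by (auto simp: less_mult_imp_div_less)
  have AB: "A * B \<in> carrier_mat n n" using A B by simp
  have "((A \<otimes>\<^sub>m 1\<^sub>m K) * (B \<otimes>\<^sub>m 1\<^sub>m K)) $$ (i, j) = (\<Sum>l<n * K. (A \<otimes>\<^sub>m 1\<^sub>m K) $$ (i, l) * (B \<otimes>\<^sub>m 1\<^sub>m K) $$ (l, j))"
    using ij kronecker_one_carrier[OF A, of K] kronecker_one_carrier[OF B, of K]
    by (auto simp: scalar_prod_def atLeast0LessThan)
  also have "\<dots> = (\<Sum>a<n. \<Sum>b<K. (A \<otimes>\<^sub>m 1\<^sub>m K) $$ (i, a * K + b) * (B \<otimes>\<^sub>m 1\<^sub>m K) $$ (a * K + b, j))"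
    by (rule sum_lessThan_mult)
  \<comment> \<open>With the inner index written as \<open>a * K + b\<close>, the first identity
    factor keeps only \<open>b = i mod K\<close>, and the second then asks for
    \<open>i mod K = j mod K\<close>.\<close>
  also have "\<dots> = (\<Sum>a<n. \<Sum>b<K. if b = i mod K then
      A $$ (i div K, a) * B $$ (a, j div K) * (if i mod K = j mod K then 1 else 0) else 0)"
  proof (intro sum.cong refl)
    fix a b assume "a \<in> {..<n}" "b \<in> {..<K}"
    then have "a * K + b < n * K" "(a * K + b) div K = a" "(a * K + b) mod K = b"
      using mult_le_mono1[of "Suc a" n K] by auto
    then show "(A \<otimes>\<^sub>m 1\<^sub>m K) $$ (i, a * K + b) * (B \<otimes>\<^sub>m 1\<^sub>m K) $$ (a * K + b, j) = (if b = i mod K then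
      A $$ (i div K, a) * B $$ (a, j div K) * (if i mod K = j mod K then 1 else 0) else 0)"
      using ij by (auto simp: kronecker_one_index[OF A] kronecker_one_index[OF B])
  qed
  also have "\<dots> = (\<Sum>a<n. A $$ (i div K, a) * B $$ (a, j div K)) * (if i mod K = j mod K then 1 else 0)"
    using K by (simp add: sum_distrib_right)
  also have "\<dots> = ((A * B) \<otimes>\<^sub>m 1\<^sub>m K) $$ (i, j)"
    using A B div by (simp add: kronecker_one_index[OF AB ij] scalar_prod_def atLeast0LessThan)
  finally show "((A \<otimes>\<^sub>m 1\<^sub>m K) * (B \<otimes>\<^sub>m 1\<^sub>m K)) $$ (i, j) = ((A * B) \<otimes>\<^sub>m 1\<^sub>m K) $$ (i, j)" .
qed (use A B in \<open>auto simp: kronecker_def\<close>)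

lemma kronecker_one_add:
  fixes A B :: "'a::comm_ring_1 mat"
  assumes A: "A \<in> carrier_mat n n" and B: "B \<in> carrier_mat n n"
  shows "A \<otimes>\<^sub>m 1\<^sub>m K + B \<otimes>\<^sub>m 1\<^sub>m K = (A + B) \<otimes>\<^sub>m 1\<^sub>m K"
proof -
  have AB: "A + B \<in> carrier_mat n n" using A B by simp
  show ?thesis
    using A B AB kronecker_one_carrier[OF A, of K] kronecker_one_carrier[OF B, of K] kronecker_one_carrier[OF AB, of K]
    by (intro eq_matI) (auto simp: kronecker_one_index[of _ n] less_mult_imp_div_less)
qed

lemma kronecker_one_one: "1\<^sub>m n \<otimes>\<^sub>m 1\<^sub>m K = (1\<^sub>m (n * K) :: 'a::comm_ring_1 mat)"
proof (rule eq_matI)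
  fix i j assume "i < dim_row (1\<^sub>m (n * K))" "j < dim_col (1\<^sub>m (n * K))"
  then have ij: "i < n * K" "j < n * K" by auto
  moreover have "i = j \<longleftrightarrow> i div K = j div K \<and> i mod K = j mod K" by (metis div_mult_mod_eq)
  ultimately show "(1\<^sub>m n \<otimes>\<^sub>m 1\<^sub>m K) $$ (i, j) = (1\<^sub>m (n * K) :: 'a mat) $$ (i, j)"
    by (auto simp: kronecker_one_index[of _ n] less_mult_imp_div_less)
qed (auto simp: kronecker_def)

text \<open>Tensoring with the identity respects products and units, so it carries inverses to
  inverses. The bound thereby reduces to inverting one \<open>n\<close> by \<open>n\<close>
  matrix.\<close>

lemma inv_mat_kronecker_one:
  fixes A C :: "'a::field mat"
  assumes "A \<in> carrier_mat n n" "C \<in> carrier_mat n n" "A * C = 1\<^sub>m n" "C * A = 1\<^sub>m n"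
  shows "inv_mat (A \<otimes>\<^sub>m 1\<^sub>m K) = C \<otimes>\<^sub>m 1\<^sub>m K"
  by (rule inv_mat_eqI[of _ "n * K"])
     (use assms in \<open>auto simp: kronecker_one_mult[of _ n] kronecker_one_one intro!: kronecker_one_carrier\<close>)

text \<open>Each diagonal entry of \<open>A\<close> fills a diagonal block of length
  \<open>K\<close>.\<close>

lemma mat_trace_kronecker_one:
  fixes A :: "'a::comm_ring_1 mat"
  assumes A: "A \<in> carrier_mat n n"
  shows "mat_trace (A \<otimes>\<^sub>m 1\<^sub>m K) = of_nat K * (\<Sum>i<n. A $$ (i, i))"
proof -
  have "mat_trace (A \<otimes>\<^sub>m 1\<^sub>m K) = (\<Sum>i<n * K. A $$ (i div K, i div K))"
    using kronecker_one_carrier[OF A, of K] by (auto simp: mat_trace_def kronecker_one_index[OF A] intro!: sum.cong)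
  also have "\<dots> = (\<Sum>a<n. \<Sum>b<K. A $$ (a, a))"
    unfolding sum_lessThan_mult by (intro sum.cong refl) auto
  finally show ?thesis by (simp add: sum_distrib_left)
qed

section \<open>Auxiliary facts on inverses, adjoints and norms\<close>

lemma inv_mat_diag:
  fixes f :: "nat \<Rightarrow> 'a::field"
  assumes "\<And>i. i < n \<Longrightarrow> f i \<noteq> 0"
  shows "inv_mat (mat_diag n f) = mat_diag n (\<lambda>i. 1 / f i)"
proof (rule inv_mat_eqI[of _ n])
  have "mat_diag n (\<lambda>i. f i * (1 / f i)) = 1\<^sub>m n" "mat_diag n (\<lambda>i. 1 / f i * f i) = 1\<^sub>m n"
    using assms by (auto simp: mat_diag_def intro!: eq_matI)
  then show "mat_diag n f * mat_diag n (\<lambda>i. 1 / f i) = 1\<^sub>m n" "mat_diag n (\<lambda>i. 1 / f i) * mat_diag n f = 1\<^sub>m n"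
    by simp_all
qed simp_all

lemma mat_adjoint_index:
  assumes "A \<in> carrier_mat m n" "i < n" "j < m"
  shows "mat_adjoint A $$ (i, j) = conjugate (A $$ (j, i))"
  using assms by (auto simp: mat_adjoint_def mat_of_rows_index)

lemma observation_mat_carrier: "observation_mat N M R L x \<in> carrier_mat (M * (L + R - 1)) (N * M * R)"
  by (auto simp: observation_mat_def transmit_mat_def kronecker_def)

lemma frobenius_norm_squared:
  assumes "A \<in> carrier_mat m n"
  shows "(frobenius_norm A)\<^sup>2 = (\<Sum>i<m. \<Sum>j<n. (cmod (A $$ (i, j)))\<^sup>2)"
  using assms unfolding frobenius_norm_def by (simp add: sum_nonneg)

subsection \<open>Translation of complex Gaussian families\<close>

lemma borel_measurable_cn_density [measurable]: "cn_density v \<in> borel_measurable borel"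
  unfolding cn_density_def by measurable

lemma cn_density_nonneg: "v > 0 \<Longrightarrow> cn_density v z \<ge> 0"
  by (simp add: cn_density_def)

lemma cmod_add_squared: "(cmod (z + b))\<^sup>2 = (cmod z)\<^sup>2 + (2 * Re (cnj b * z) + (cmod b)\<^sup>2)"
  unfolding cmod_power2 by (simp add: power2_eq_square algebra_simps)

lemma cn_density_shift:
  "cn_density v (z + b) = cn_density v z * exp (- (2 * Re (cnj b * z) + (cmod b)\<^sup>2) / v)"
  by (simp add: cn_density_def cmod_add_squared exp_add [symmetric] diff_divide_distrib add_divide_distrib)

text \<open>Lebesgue measure is translation invariant, so a translation only changes the Gaussian
  density, by the ratio in \<open>cn_density_shift\<close>. Stated as a weighted push-forward, the
  identity can be multiplied over coordinates.\<close>

lemma cn_measure_shift: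
  assumes "v > 0"
  defines "N \<equiv> density lborel (\<lambda>z. ennreal (cn_density v z))"
  shows "N = distr (density N (\<lambda>z. ennreal (exp (- (2 * Re (cnj b * z) + (cmod b)\<^sup>2) / v)))) N (\<lambda>z. z + b)"
proof (rule measure_eqI)
  fix E assume "E \<in> sets N"
  then have [measurable]: "E \<in> sets borel" by (simp add: N_def)
  then have [measurable]: "(\<lambda>z. z + b) -` E \<in> sets borel"
    using measurable_sets[of "\<lambda>z. z + b" borel borel E] by simp
  have "emeasure N E = (\<integral>\<^sup>+z. ennreal (cn_density v z) * indicator E z \<partial>lborel)"
    unfolding N_def by (subst emeasure_density) auto
  also have "\<dots> = (\<integral>\<^sup>+z. ennreal (cn_density v z) * indicator E z \<partial>distr lborel borel ((+) b))"
    by (simp only: lborel_distr_plus)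
  also have "\<dots> = (\<integral>\<^sup>+z. ennreal (cn_density v (z + b)) * indicator E (z + b) \<partial>lborel)"
    by (subst nn_integral_distr) (auto simp: add.commute)
  also have "\<dots> = (\<integral>\<^sup>+z. ennreal (cn_density v z) *
      (ennreal (exp (- (2 * Re (cnj b * z) + (cmod b)\<^sup>2) / v)) * indicator E (z + b)) \<partial>lborel)"
    by (simp add: cn_density_shift ennreal_mult' cn_density_nonneg assms mult.assoc)
  also have "\<dots> = (\<integral>\<^sup>+z. ennreal (exp (- (2 * Re (cnj b * z) + (cmod b)\<^sup>2) / v)) * indicator E (z + b) \<partial>N)"
    unfolding N_def by (subst nn_integral_density) auto
  also have "\<dots> = (\<integral>\<^sup>+z. ennreal (exp (- (2 * Re (cnj b * z) + (cmod b)\<^sup>2) / v)) * indicator ((\<lambda>z. z + b) -` E \<inter> space N) z \<partial>N)"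
    by (auto intro!: nn_integral_cong simp: indicator_def N_def)
  also have "\<dots> = emeasure (distr (density N (\<lambda>z. ennreal (exp (- (2 * Re (cnj b * z) + (cmod b)\<^sup>2) / v)))) N (\<lambda>z. z + b)) E"
    by (subst emeasure_distr) (auto simp: N_def intro!: emeasure_density[symmetric])
  finally show "emeasure N E = \<dots>" .
qed simp

text \<open>A product measure is determined by its values on boxes. There the weight and the
  indicator of the preimage are both products over coordinates, so the integral splits and each
  factor is the one-coordinate identity.\<close>

lemma (in product_sigma_finite) PiM_eq_distr_density:
  assumes "finite I"
    and T [measurable]: "\<And>i. i \<in> I \<Longrightarrow> T i \<in> measurable (M i) (M i)"
    and L [measurable]: "\<And>i. i \<in> I \<Longrightarrow> L i \<in> borel_measurable (M i)"
    and eq: "\<And>i. i \<in> I \<Longrightarrow> M i = distr (density (M i) (L i)) (M i) (T i)"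
  shows "PiM I M = distr (density (PiM I M) (\<lambda>z. \<Prod>i\<in>I. L i (z i))) (PiM I M) (\<lambda>z. \<lambda>i\<in>I. T i (z i))"
proof (rule PiM_eqI [symmetric])
  show "finite I" by fact
  fix A assume A [measurable]: "\<And>i. i \<in> I \<Longrightarrow> A i \<in> sets (M i)"
  have box: "Pi\<^sub>E I A \<in> sets (PiM I M)"
    by (intro sets_PiM_I_finite assms A)
  have TM: "(\<lambda>z. \<lambda>i\<in>I. T i (z i)) \<in> measurable (PiM I M) (PiM I M)" by measurable
  have "emeasure (distr (density (PiM I M) (\<lambda>z. \<Prod>i\<in>I. L i (z i))) (PiM I M) (\<lambda>z. \<lambda>i\<in>I. T i (z i))) (Pi\<^sub>E I A)
    = (\<integral>\<^sup>+z. (\<Prod>i\<in>I. L i (z i)) * indicator ((\<lambda>z. \<lambda>i\<in>I. T i (z i)) -` Pi\<^sub>E I A \<inter> space (PiM I M)) z \<partial>PiM I M)"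
    by (subst emeasure_distr[OF _ box]) (auto intro!: emeasure_density measurable_sets[OF TM box] TM)
  also have "\<dots> = (\<integral>\<^sup>+z. (\<Prod>i\<in>I. L i (z i) * indicator (A i) (T i (z i))) \<partial>PiM I M)"
  proof (rule nn_integral_cong)
    fix z assume z: "z \<in> space (PiM I M)"
    have "(\<Prod>i\<in>I. indicator (A i) (T i (z i))) = (indicator ((\<lambda>z. \<lambda>i\<in>I. T i (z i)) -` Pi\<^sub>E I A \<inter> space (PiM I M)) z :: ennreal)"
      using z \<open>finite I\<close> by (cases "\<forall>i\<in>I. T i (z i) \<in> A i") (auto simp: indicator_def PiE_def Pi_def)
    then show "(\<Prod>i\<in>I. L i (z i)) * indicator ((\<lambda>z. \<lambda>i\<in>I. T i (z i)) -` Pi\<^sub>E I A \<inter> space (PiM I M)) z =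
      (\<Prod>i\<in>I. L i (z i) * indicator (A i) (T i (z i)))"
      by (simp add: prod.distrib)
  qed
  also have "\<dots> = (\<Prod>i\<in>I. \<integral>\<^sup>+z. L i z * indicator (A i) (T i z) \<partial>M i)"
    by (rule product_nn_integral_prod) (use \<open>finite I\<close> in auto)
  also have "\<dots> = (\<Prod>i\<in>I. emeasure (M i) (A i))"
  proof (rule prod.cong)
    fix i assume i: "i \<in> I"
    have "emeasure (M i) (A i) = emeasure (distr (density (M i) (L i)) (M i) (T i)) (A i)"
      using eq[OF i] by simp
    also have "\<dots> = (\<integral>\<^sup>+z. L i z * indicator (T i -` A i \<inter> space (M i)) z \<partial>M i)"
      by (subst emeasure_distr) (use i in \<open>auto intro!: emeasure_density\<close>)
    also have "\<dots> = (\<integral>\<^sup>+z. L i z * indicator (A i) (T i z) \<partial>M i)"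
      by (auto intro!: nn_integral_cong simp: indicator_def)
    finally show "(\<integral>\<^sup>+z. L i z * indicator (A i) (T i z) \<partial>M i) = emeasure (M i) (A i)" by simp
  qed simp
  finally show "emeasure (distr (density (PiM I M) (\<lambda>z. \<Prod>i\<in>I. L i (z i))) (PiM I M) (\<lambda>z. \<lambda>i\<in>I. T i (z i))) (Pi\<^sub>E I A)
    = (\<Prod>i\<in>I. emeasure (M i) (A i))" .
qed simp

section \<open>Vanishing first moments from a tilting identity\<close>

text \<open>Since \<open>exp y \<ge> 1 + y\<close>, the mean \<open>m\<close> of \<open>G * s\<close> satisfies \<open>2 * t * m \<le> E G * (exp (t\<^sup>2 * c) - 1)\<close>,
  whose right-hand side is quadratically small in \<open>t\<close>.\<close>

lemma integral_score_eq_0_nonneg: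
  fixes G s :: "'a \<Rightarrow> real"
  assumes G: "integrable P G" and G0: "\<And>w. G w \<ge> 0" and s [measurable]: "s \<in> borel_measurable P"
    and tilt: "\<And>t::real. (\<integral>\<^sup>+w. ennreal (G w) \<partial>P) = (\<integral>\<^sup>+w. ennreal (G w * exp (2 * t * s w - t\<^sup>2 * c)) \<partial>P)"
  shows "integrable P (\<lambda>w. G w * s w)" "(\<integral>w. G w * s w \<partial>P) = 0"
proof -
  have [measurable]: "G \<in> borel_measurable P" using G by simp
  have int: "integrable P (\<lambda>w. G w * exp (2 * t * s w - t\<^sup>2 * c))" for t
  proof (rule integrableI_nonneg)
    show "(\<integral>\<^sup>+w. ennreal (G w * exp (2 * t * s w - t\<^sup>2 * c)) \<partial>P) < \<infinity>"
      using G tilt[of t] by (simp add: real_integrable_def less_top)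
  qed (use G0 in auto)
  have val: "(\<integral>w. G w * exp (2 * t * s w - t\<^sup>2 * c) \<partial>P) = (\<integral>w. G w \<partial>P)" for t
    using tilt[of t] G0 by (simp add: integral_eq_nn_integral)
  have exp_int: "integrable P (\<lambda>w. G w * exp (2 * t * s w))" for t
    using integrable_mult_left[OF int[of t], of "exp (t\<^sup>2 * c)"]
    by (simp add: mult.assoc exp_add[symmetric])
  have exp_val: "(\<integral>w. G w * exp (2 * t * s w) \<partial>P) = (\<integral>w. G w \<partial>P) * exp (t\<^sup>2 * c)" for t
    unfolding val[of t, symmetric] integral_mult_left_zero[symmetric]
    by (simp add: mult.assoc exp_add[symmetric])
  \<comment> \<open>The cases \<open>t = 1\<close> and \<open>t = -1\<close> supply an integrable
    majorant, since \<open>\<bar>y\<bar> \<le> exp (2 * y) + exp (- 2 * y)\<close>.\<close>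
  show Gs: "integrable P (\<lambda>w. G w * s w)"
  proof (rule Bochner_Integration.integrable_bound)
    show "integrable P (\<lambda>w. G w * exp (2 * 1 * s w) + G w * exp (2 * (-1) * s w))"
      by (intro Bochner_Integration.integrable_add exp_int)
    have "\<bar>y\<bar> \<le> exp (2 * y) + exp (- 2 * y)" for y :: real
      using exp_ge_add_one_self[of "2 * y"] exp_ge_add_one_self[of "- 2 * y"] exp_gt_zero[of "2 * y"] exp_gt_zero[of "- 2 * y"]
      by linarith
    then have "G w * \<bar>s w\<bar> \<le> G w * (exp (2 * s w) + exp (- 2 * s w))" for w
      by (intro mult_left_mono G0)
    then show "AE w in P. norm (G w * s w) \<le> norm (G w * exp (2 * 1 * s w) + G w * exp (2 * (-1) * s w))"
      using G0 by (simp add: abs_mult distrib_left)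
  qed auto
  let ?g = "\<integral>w. G w \<partial>P" and ?m = "\<integral>w. G w * s w \<partial>P"
  have bound: "2 * t * ?m \<le> ?g * (exp (t\<^sup>2 * c) - 1)" for t
  proof -
    have "(\<integral>w. G w + 2 * t * (G w * s w) \<partial>P) \<le> (\<integral>w. G w * exp (2 * t * s w) \<partial>P)"
    proof (rule integral_mono)
      show "integrable P (\<lambda>w. G w + 2 * t * (G w * s w))" using G Gs by simp
      show "integrable P (\<lambda>w. G w * exp (2 * t * s w))" by (rule exp_int)
      show "G w + 2 * t * (G w * s w) \<le> G w * exp (2 * t * s w)" for w
        using mult_left_mono[OF exp_ge_add_one_self[of "2 * t * s w"] G0[of w]] by (simp add: algebra_simps)
    qed
    then show ?thesis using G Gs by (simp add: exp_val right_diff_distrib)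
  qed
  have der: "((\<lambda>t. ?g * (exp (t\<^sup>2 * c) - 1) - 2 * t * ?m) has_real_derivative - 2 * ?m) (at 0)"
    by (auto intro!: derivative_eq_intros)
  \<comment> \<open>By \<open>bound\<close> the function is nonnegative, and it is zero at
    \<open>t = 0\<close>. Its derivative at this minimum vanishes; the exponential, a function of
    the square of \<open>t\<close>, contributes nothing to it.\<close>
  have "- 2 * ?m = 0"
    by (rule DERIV_local_min[OF der, of 1]) (use bound in \<open>auto simp: algebra_simps\<close>)
  then show "?m = 0" by simp
qed

text \<open>A signed \<open>G\<close> is split into its positive and negative parts. Both have the
  form \<open>f (G w)\<close> with \<open>f\<close> nonnegative, which is why the tilting identity
  is assumed for all such \<open>f\<close>.\<close>

lemma integral_score_eq_0:
  fixes G s :: "'a \<Rightarrow> real"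
  assumes G: "integrable P G" and s: "s \<in> borel_measurable P"
    and tilt: "\<And>(f :: real \<Rightarrow> real) t. f \<in> borel_measurable borel \<Longrightarrow> (\<And>x. f x \<ge> 0) \<Longrightarrow>
      (\<integral>\<^sup>+w. ennreal (f (G w)) \<partial>P) = (\<integral>\<^sup>+w. ennreal (f (G w) * exp (2 * t * s w - t\<^sup>2 * c)) \<partial>P)"
  shows "integrable P (\<lambda>w. G w * s w)" "(\<integral>w. G w * s w \<partial>P) = 0"
proof -
  note pos = integral_score_eq_0_nonneg[of P "\<lambda>w. max 0 (G w)" s c, OF _ _ s tilt[of "max 0"]]
  note neg = integral_score_eq_0_nonneg[of P "\<lambda>w. max 0 (- G w)" s c, OF _ _ s tilt[of "\<lambda>x. max 0 (- x)"]]
  have *: "(\<lambda>w. G w * s w) = (\<lambda>w. max 0 (G w) * s w - max 0 (- G w) * s w)"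
    by (auto simp: max_def)
  show "integrable P (\<lambda>w. G w * s w)" "(\<integral>w. G w * s w \<partial>P) = 0"
    unfolding * using pos neg G by auto
qed

section \<open>Translation of Gaussian matrices\<close>

text \<open>The logarithm of the density ratio \<open>p (A + B) / p A\<close>.\<close>

definition tilt_exponent :: "nat \<Rightarrow> nat \<Rightarrow> (nat \<Rightarrow> real) \<Rightarrow> complex mat \<Rightarrow> complex mat \<Rightarrow> real" where
  "tilt_exponent m n v B A =
    (\<Sum>(i, j)\<in>{..<m} \<times> {..<n}. - (2 * Re (cnj (B $$ (i, j)) * A $$ (i, j)) + (cmod (B $$ (i, j)))\<^sup>2) / v i)"

lemma measurable_mat_entry [measurable]:
  "i < m \<Longrightarrow> j < n \<Longrightarrow> (\<lambda>A. A $$ (i, j)) \<in> borel_measurable (mat_borel m n)"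
  using measurable_mat_borel_iff[of "\<lambda>A. A" "mat_borel m n" m n] by auto

lemma measurable_tilt_exponent [measurable]: "tilt_exponent m n v B \<in> borel_measurable (mat_borel m n)"
  unfolding tilt_exponent_def by (intro borel_measurable_sum) (auto simp: split_beta)

lemma measurable_mat_PiM [measurable]:
  "mat m n \<in> measurable (\<Pi>\<^sub>M p\<in>{..<m} \<times> {..<n}. (borel :: complex measure)) (mat_borel m n)"
  unfolding measurable_mat_borel_iff by auto

text \<open>Independence makes the joint law of the entries the product of their laws, and
  \<open>mat m n\<close> rebuilds the matrix from its entries. Positive dimensions keep the index
  set nonempty, as the product characterisation of independence asks.\<close>

lemma distr_indep_cn_entries:
  assumes "prob_space P" and A: "indep_cn_entries P m n v A" and "m > 0" "n > 0"
  shows "distr P (mat_borel m n) A =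
    distr (\<Pi>\<^sub>M p\<in>{..<m} \<times> {..<n}. density lborel (\<lambda>z. ennreal (cn_density (v (fst p)) z))) (mat_borel m n) (mat m n)"
proof -
  interpret prob_space P by fact
  let ?I = "{..<m} \<times> {..<n}"
  let ?N = "\<lambda>p. density lborel (\<lambda>z. ennreal (cn_density (v (fst p)) z))"
  from A have meas: "A \<in> measurable P (mat_borel m n)"
    and ind: "indep_vars (\<lambda>_. borel) (\<lambda>p w. A w $$ p) ?I"
    and dist: "\<And>i j. i < m \<Longrightarrow> j < n \<Longrightarrow> distributed P lborel (\<lambda>w. A w $$ (i, j)) (\<lambda>z. ennreal (cn_density (v i) z))"
    unfolding indep_cn_entries_def by auto
  have rv: "(\<lambda>w. A w $$ p) \<in> borel_measurable P" if "p \<in> ?I" for p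
    using meas that unfolding measurable_mat_borel_iff by auto
  have "distr P (\<Pi>\<^sub>M p\<in>?I. borel) (\<lambda>w. \<lambda>p\<in>?I. A w $$ p) = (\<Pi>\<^sub>M p\<in>?I. distr P borel (\<lambda>w. A w $$ p))"
    using ind assms(3,4) rv by (subst indep_vars_iff_distr_eq_PiM'[symmetric]) auto
  also have "\<dots> = (\<Pi>\<^sub>M p\<in>?I. ?N p)"
  proof (rule PiM_cong)
    fix p assume "p \<in> ?I"
    then have "distr P lborel (\<lambda>w. A w $$ p) = ?N p"
      using dist by (auto simp: distributed_def)
    moreover have "distr P borel (\<lambda>w. A w $$ p) = distr P lborel (\<lambda>w. A w $$ p)"
      by (rule distr_cong) auto
    ultimately show "distr P borel (\<lambda>w. A w $$ p) = ?N p" by simp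
  qed simp
  finally have *: "distr P (\<Pi>\<^sub>M p\<in>?I. borel) (\<lambda>w. \<lambda>p\<in>?I. A w $$ p) = (\<Pi>\<^sub>M p\<in>?I. ?N p)" .
  have "distr P (mat_borel m n) A = distr P (mat_borel m n) (\<lambda>w. mat m n (\<lambda>p\<in>?I. A w $$ p))"
    using measurable_space[OF meas] by (intro distr_cong) (fastforce intro!: eq_matI dest: carrier_matD)+
  also have "\<dots> = distr (distr P (\<Pi>\<^sub>M p\<in>?I. borel) (\<lambda>w. \<lambda>p\<in>?I. A w $$ p)) (mat_borel m n) (mat m n)"
    by (subst distr_distr[OF measurable_mat_PiM]) (auto intro!: measurable_restrict rv simp: comp_def)
  finally show ?thesis unfolding * .
qed

text \<open>Each coordinate shifts as in \<open>cn_measure_shift\<close>, and the product of the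
  coordinate ratios is the exponential of \<open>tilt_exponent\<close>.\<close>

lemma nn_integral_indep_cn_entries_shift:
  assumes P: "prob_space P" and A: "indep_cn_entries P m n v A" and mn: "m > 0" "n > 0"
    and v: "\<And>i. i < m \<Longrightarrow> v i > 0"
    and B: "B \<in> carrier_mat m n" and F [measurable]: "F \<in> borel_measurable (mat_borel m n)"
  defines "D \<equiv> distr P (mat_borel m n) A"
  shows "(\<integral>\<^sup>+a. F a \<partial>D) = (\<integral>\<^sup>+a. ennreal (exp (tilt_exponent m n v B a)) * F (a + B) \<partial>D)"
proof -
  interpret prob_space P by fact
  let ?I = "{..<m} \<times> {..<n}"
  define N where "N p = density lborel (\<lambda>z. ennreal (cn_density (v (fst p)) z))" for p :: "nat \<times> nat"
  define L where "L p z = ennreal (exp (- (2 * Re (cnj (B $$ p) * z) + (cmod (B $$ p))\<^sup>2) / v (fst p)))" for p z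
  note dist = distr_indep_cn_entries[OF P A mn, folded N_def]
  from A have meas [measurable]: "A \<in> measurable P (mat_borel m n)" unfolding indep_cn_entries_def by auto
  have prob_N: "prob_space (N p)" if p: "p \<in> ?I" for p
  proof -
    have "distributed P lborel (\<lambda>w. A w $$ p) (\<lambda>z. ennreal (cn_density (v (fst p)) z))"
      using p A unfolding indep_cn_entries_def by auto
    then show ?thesis unfolding N_def distributed_def by (metis prob_space_distr)
  qed
  \<comment> \<open>Outside the index grid \<open>v\<close> may fail to be positive, while
    \<open>product_sigma_finite\<close> asks for sigma-finiteness at every index. The law at
    \<open>(0, 0)\<close> serves as default there.\<close>
  define N' where "N' p = (if p \<in> ?I then N p else N (0, 0))" for p
  have N': "(\<Pi>\<^sub>M p\<in>?I. N p) = (\<Pi>\<^sub>M p\<in>?I. N' p)"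
    by (rule PiM_cong) (auto simp: N'_def)
  have setsN [measurable_cong]: "sets (N' p) = sets borel" for p by (simp add: N'_def N_def)
  have [measurable]: "L p \<in> borel_measurable (N' p)" for p unfolding L_def by measurable
  have "sigma_finite_measure (N' p)" for p
    using prob_N[of "if p \<in> ?I then p else (0, 0)"] mn
    by (cases "p \<in> ?I") (simp_all add: N'_def prob_space_imp_sigma_finite)
  then interpret product_sigma_finite N'
    by (rule product_sigma_finite.intro)
  have sh: "(\<Pi>\<^sub>M p\<in>?I. N' p) = distr (density (\<Pi>\<^sub>M p\<in>?I. N' p) (\<lambda>z. \<Prod>p\<in>?I. L p (z p))) (\<Pi>\<^sub>M p\<in>?I. N' p) (\<lambda>z. \<lambda>p\<in>?I. z p + B $$ p)"
  proof (rule PiM_eq_distr_density)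
    fix p assume p: "p \<in> ?I"
    then have "v (fst p) > 0" using v by auto
    from cn_measure_shift[OF this, of "B $$ p", folded N_def] p
    show "N' p = distr (density (N' p) (L p)) (N' p) (\<lambda>z. z + B $$ p)"
      by (simp add: N'_def L_def[abs_def])
  qed auto
  have F' [measurable]: "(\<lambda>z. F (mat m n z)) \<in> borel_measurable (\<Pi>\<^sub>M p\<in>?I. N' p)"
    by measurable
  have setsP: "sets (\<Pi>\<^sub>M p\<in>?I. N' p) = sets (\<Pi>\<^sub>M p\<in>?I. borel)" by (intro sets_PiM_cong refl setsN)
  have matm [measurable]: "mat m n \<in> measurable (\<Pi>\<^sub>M p\<in>?I. N' p) (mat_borel m n)"
    using measurable_mat_PiM setsP by (simp cong: measurable_cong_sets)
  have expL: "(\<Prod>p\<in>?I. L p (z p)) = ennreal (exp (tilt_exponent m n v B (mat m n z)))" for z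
  proof -
    have "tilt_exponent m n v B (mat m n z) = (\<Sum>p\<in>?I. - (2 * Re (cnj (B $$ p) * z p) + (cmod (B $$ p))\<^sup>2) / v (fst p))"
      unfolding tilt_exponent_def by (intro sum.cong) auto
    then show ?thesis by (simp add: L_def exp_sum prod_ennreal)
  qed
  have shm: "mat m n (\<lambda>p\<in>?I. z p + B $$ p) = mat m n z + B" for z
    using B by (auto intro!: eq_matI)
  have addB [measurable]: "(\<lambda>A. A + B) \<in> measurable (mat_borel m n) (mat_borel m n)"
    using B by (subst measurable_mat_borel_iff) (auto cong: measurable_cong)
  have "(\<integral>\<^sup>+a. F a \<partial>D) = (\<integral>\<^sup>+z. F (mat m n z) \<partial>(\<Pi>\<^sub>M p\<in>?I. N' p))"
    unfolding D_def dist N' by (rule nn_integral_distr) auto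
  also have "\<dots> = (\<integral>\<^sup>+z. (\<Prod>p\<in>?I. L p (z p)) * F (mat m n (\<lambda>p\<in>?I. z p + B $$ p)) \<partial>(\<Pi>\<^sub>M p\<in>?I. N' p))"
    by (subst sh, subst nn_integral_distr) (auto intro!: nn_integral_density)
  also have "\<dots> = (\<integral>\<^sup>+z. ennreal (exp (tilt_exponent m n v B (mat m n z))) * F (mat m n z + B) \<partial>(\<Pi>\<^sub>M p\<in>?I. N' p))"
    by (simp only: expL shm)
  also have "\<dots> = (\<integral>\<^sup>+a. ennreal (exp (tilt_exponent m n v B a)) * F (a + B) \<partial>D)"
    unfolding D_def dist N' by (rule nn_integral_distr[symmetric]) auto
  finally show ?thesis .
qed

subsection \<open>Moments of complex Gaussian variables\<close>

text \<open>Lebesgue measure is characterised by its values on boxes, and the boxes of the complex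
  plane are the open rectangles.\<close>

lemma lborel_complex: "(lborel :: complex measure) = distr (lborel \<Otimes>\<^sub>M lborel) borel (\<lambda>(x, y). Complex x y)"
proof (rule lborel_eqI)
  have [measurable]: "(\<lambda>(x, y). Complex x y) \<in> borel_measurable (lborel \<Otimes>\<^sub>M lborel)"
    by (simp add: split_beta Complex_eq)
  fix l u :: complex assume le: "\<And>b. b \<in> Basis \<Longrightarrow> l \<bullet> b \<le> u \<bullet> b"
  have le: "Re l \<le> Re u" "Im l \<le> Im u"
    using le[of 1] le[of \<i>] by (auto simp: Basis_complex_def)
  have "(\<lambda>(x, y). Complex x y) -` box l u = {Re l<..<Re u} \<times> {Im l<..<Im u}"
    by (auto simp: box_def Basis_complex_def)
  then have "emeasure (distr (lborel \<Otimes>\<^sub>M lborel) borel (\<lambda>(x, y). Complex x y)) (box l u) =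
    emeasure lborel {Re l<..<Re u} * emeasure lborel {Im l<..<Im u}"
    by (subst emeasure_distr) (auto simp: space_pair_measure lborel.emeasure_pair_measure_Times)
  also have "\<dots> = (\<Prod>b\<in>Basis. (u - l) \<bullet> b)"
    using le by (simp add: Basis_complex_def ennreal_mult')
  finally show "emeasure (distr (lborel \<Otimes>\<^sub>M lborel) borel (\<lambda>(x, y). Complex x y)) (box l u) = (\<Prod>b\<in>Basis. (u - l) \<bullet> b)" .
qed simp

text \<open>Real and imaginary part each carry half the variance, whence the standard deviation
  \<open>sqrt (v / 2)\<close>.\<close>

lemma cn_density_Complex:
  assumes "v > 0"
  shows "cn_density v (Complex x y) = normal_density 0 (sqrt (v / 2)) x * normal_density 0 (sqrt (v / 2)) y"
  using assms
  by (simp add: cn_density_def normal_density_def cmod_power2 exp_add[symmetric] add_divide_distrib diff_divide_distrib)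

text \<open>By \<open>lborel_complex\<close> the law of \<open>Z\<close> is the image of a planar
  density under \<open>Complex\<close>, and taking real and imaginary parts undoes that map.\<close>

lemma (in prob_space) distributed_cn_Re_Im:
  assumes v: "v > 0" and Z: "distributed M lborel Z (\<lambda>z. ennreal (cn_density v z))"
  shows "distributed M (lborel \<Otimes>\<^sub>M lborel) (\<lambda>w. (Re (Z w), Im (Z w)))
    (\<lambda>(x, y). ennreal (normal_density 0 (sqrt (v / 2)) x) * ennreal (normal_density 0 (sqrt (v / 2)) y))"
proof -
  let ?L = "lborel \<Otimes>\<^sub>M lborel :: (real \<times> real) measure"
  let ?c = "\<lambda>z. ennreal (cn_density v z)"
  have Zm [measurable]: "Z \<in> borel_measurable M"
    using Z by (simp add: distributed_def)
  have dens: "(\<lambda>p. ennreal (cn_density v (case p of (x, y) \<Rightarrow> Complex x y))) = (\<lambda>(x, y). ennreal (normal_density 0 (sqrt (v / 2)) x) * ennreal (normal_density 0 (sqrt (v / 2)) y))"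
    using v by (auto simp: cn_density_Complex ennreal_mult')
  have C [measurable]: "(\<lambda>(x, y). Complex x y) \<in> borel_measurable ?L"
    by (simp add: split_beta Complex_eq)
  have RI [measurable]: "(\<lambda>z. (Re z, Im z)) \<in> measurable borel ?L"
    by measurable
  have "distr M ?L (\<lambda>w. (Re (Z w), Im (Z w))) = distr (distr M lborel Z) ?L (\<lambda>z. (Re z, Im z))"
    by (subst distr_distr) (auto simp: comp_def)
  also have "\<dots> = distr (density lborel ?c) ?L (\<lambda>z. (Re z, Im z))"
    using Z by (simp add: distributed_def)
  also have "\<dots> = distr (density (distr ?L borel (\<lambda>(x, y). Complex x y)) ?c) ?L (\<lambda>z. (Re z, Im z))"
    by (simp only: lborel_complex)
  also have "\<dots> = distr (distr (density ?L (\<lambda>p. ?c (case p of (x, y) \<Rightarrow> Complex x y))) borel (\<lambda>(x, y). Complex x y)) ?L (\<lambda>z. (Re z, Im z))"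
    by (subst density_distr) auto
  also have "\<dots> = distr (density ?L (\<lambda>p. ?c (case p of (x, y) \<Rightarrow> Complex x y))) ?L (\<lambda>p. p)"
    by (subst distr_distr) (auto simp: comp_def split_beta)
  also have "\<dots> = density ?L (\<lambda>p. ?c (case p of (x, y) \<Rightarrow> Complex x y))"
    by (rule distr_id2) simp
  finally have "distr M ?L (\<lambda>w. (Re (Z w), Im (Z w))) = density ?L (\<lambda>p. ?c (case p of (x, y) \<Rightarrow> Complex x y))" .
  then show ?thesis unfolding distributed_def dens by simp
qed

lemma (in prob_space) normal_distributed_moments:
  assumes s: "s > 0" and X: "distributed M lborel X (normal_density 0 s)"
  shows "integrable M X" "expectation X = 0" "integrable M (\<lambda>w. (X w)\<^sup>2)" "expectation (\<lambda>w. (X w)\<^sup>2) = s\<^sup>2"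
proof -
  show "integrable M X"
    using distributed_integrable[OF X, of "\<lambda>x. x"] integrable_normal_moment[OF s, of 0 1] by simp
  show *: "expectation X = 0"
    by (rule normal_distributed_expectation[OF s X])
  show "integrable M (\<lambda>w. (X w)\<^sup>2)"
    using distributed_integrable[OF X, of "\<lambda>x. x\<^sup>2"] integrable_normal_moment[OF s, of 0 2] by simp
  show "expectation (\<lambda>w. (X w)\<^sup>2) = s\<^sup>2"
    using normal_distributed_variance[OF s X] * by simp
qed

text \<open>Integrating out one coordinate shows that both parts of \<open>Z\<close> are centred
  normal with variance \<open>v / 2\<close>. The mean of the squared modulus adds the two
  variances.\<close>

lemma (in prob_space) cn_moments:
  assumes v: "v > 0" and Z: "distributed M lborel Z (\<lambda>z. ennreal (cn_density v z))"
  shows "integrable M Z" "expectation Z = 0" "integrable M (\<lambda>w. (cmod (Z w))\<^sup>2)" "expectation (\<lambda>w. (cmod (Z w))\<^sup>2) = v"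
proof -
  let ?s = "sqrt (v / 2)"
  let ?n = "normal_density 0 ?s"
  have s: "?s > 0" and s2: "?s\<^sup>2 = v / 2" using v by auto
  have n1: "(\<integral>\<^sup>+x. ennreal (?n x) \<partial>lborel) = 1"
    using integrable_normal_density[OF s, of 0] integral_normal_density[OF s, of 0] by (simp add: nn_integral_eq_integral)
  have marg: "(\<integral>\<^sup>+y. ennreal (?n x) * ennreal (?n y) \<partial>lborel) = ennreal (?n x)"
    "(\<integral>\<^sup>+y. ennreal (?n y) * ennreal (?n x) \<partial>lborel) = ennreal (?n x)" for x
    by (simp_all add: nn_integral_cmult nn_integral_multc n1)
  note D = distributed_cn_Re_Im[OF v Z]
  have Re: "distributed M lborel (\<lambda>w. Re (Z w)) ?n"
    using distr_marginal1[OF sigma_finite_lborel sigma_finite_lborel D] by (simp add: marg)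
  have Im: "distributed M lborel (\<lambda>w. Im (Z w)) ?n"
    using distr_marginal2[OF sigma_finite_lborel sigma_finite_lborel D] by (simp add: marg)
  note R = normal_distributed_moments[OF s Re] and I = normal_distributed_moments[OF s Im]
  have "integrable M (\<lambda>w. complex_of_real (Re (Z w)) + \<i> * complex_of_real (Im (Z w)))"
    using R I by (intro Bochner_Integration.integrable_add integrable_mult_right integrable_of_real) auto
  then show int: "integrable M Z" by (simp add: complex_eq[symmetric])
  show "expectation Z = 0"
    using R I by (simp add: complex_eq_iff integral_Re[OF int, symmetric] integral_Im[OF int, symmetric])
  show "integrable M (\<lambda>w. (cmod (Z w))\<^sup>2)" "expectation (\<lambda>w. (cmod (Z w))\<^sup>2) = v"
    using R I s2 by (simp_all add: cmod_power2)
qed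

lemma borel_measurable_cnj [measurable]: "cnj \<in> borel_measurable borel"
  by (intro borel_measurable_continuous_onI continuous_intros)

lemma (in prob_space) indep_cn_entries_covariance:
  assumes A: "indep_cn_entries M m n v A" and v: "\<forall>i<m. v i > 0" and "i < m" "j < m" "k < n"
  shows "integrable M (\<lambda>w. A w $$ (i, k) * cnj (A w $$ (j, k)))"
    "expectation (\<lambda>w. A w $$ (i, k) * cnj (A w $$ (j, k))) = (if i = j then complex_of_real (v i) else 0)"
proof -
  have dist: "distributed M lborel (\<lambda>w. A w $$ (l, k)) (\<lambda>z. ennreal (cn_density (v l) z))" if "l < m" for l
    using A that assms(5) unfolding indep_cn_entries_def by auto
  note mom = cn_moments[OF _ dist]
  have "integrable M (\<lambda>w. A w $$ (i, k) * cnj (A w $$ (j, k))) \<and>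
    expectation (\<lambda>w. A w $$ (i, k) * cnj (A w $$ (j, k))) = (if i = j then complex_of_real (v i) else 0)"
  proof (cases "i = j")
    case True
    have "integrable M (\<lambda>w. complex_of_real ((cmod (A w $$ (i, k)))\<^sup>2))"
      by (rule integrable_of_real) (use mom(3) v assms(3) in auto)
    then show ?thesis
      using mom(4)[of i] v assms(3)
      by (simp add: True complex_norm_square[symmetric] integral_complex_of_real del: of_real_power)
  next
    case False
    \<comment> \<open>The second entry is conjugated beforehand, so that the product rule for
      independent families gives the covariance directly. A centred factor makes it vanish.\<close>
    let ?f = "\<lambda>p. if p = (i, k) then (\<lambda>z. z) else cnj"
    have "indep_vars (\<lambda>_. borel) (\<lambda>p w. A w $$ p) {(i, k), (j, k)}"
      using A assms(3-5) unfolding indep_cn_entries_def by (auto elim!: indep_vars_subset)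
    then have ind: "indep_vars (\<lambda>_. borel) (\<lambda>p w. ?f p (A w $$ p)) {(i, k), (j, k)}"
      by (rule indep_vars_compose2) auto
    have int: "integrable M (\<lambda>w. ?f p (A w $$ p))" if "p \<in> {(i, k), (j, k)}" for p
      using that mom(1) v assms(3,4) by auto
    have "expectation (\<lambda>w. A w $$ (i, k)) = 0"
      using mom(2) v assms(3) by auto
    with indep_vars_lebesgue_integral[OF _ ind int] indep_vars_integrable[OF _ ind int] False
    show ?thesis by simp
  qed
  then show "integrable M (\<lambda>w. A w $$ (i, k) * cnj (A w $$ (j, k)))"
    "expectation (\<lambda>w. A w $$ (i, k) * cnj (A w $$ (j, k))) = (if i = j then complex_of_real (v i) else 0)"
    by auto
qed

subsection \<open>Orthogonality of the score\<close>

text \<open>The real inner product of \<open>B\<close> and \<open>A\<close> weighted by inverse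
  variances. Up to the factor -2, it is the part of \<open>tilt_exponent\<close> that is linear in
  the shift.\<close>

definition score_pairing :: "nat \<Rightarrow> nat \<Rightarrow> (nat \<Rightarrow> real) \<Rightarrow> complex mat \<Rightarrow> complex mat \<Rightarrow> real" where
  "score_pairing m n v B A = (\<Sum>(i, j)\<in>{..<m} \<times> {..<n}. Re (cnj (B $$ (i, j)) * A $$ (i, j)) / v i)"

lemma measurable_score_pairing [measurable]: "score_pairing m n v B \<in> borel_measurable (mat_borel m n)"
  unfolding score_pairing_def by (intro borel_measurable_sum) (auto simp: split_beta)

lemma tilt_exponent_smult:
  assumes "B \<in> carrier_mat m n"
  shows "tilt_exponent m n v (complex_of_real t \<cdot>\<^sub>m B) A =
    - 2 * t * score_pairing m n v B A - t\<^sup>2 * (\<Sum>(i, j)\<in>{..<m} \<times> {..<n}. (cmod (B $$ (i, j)))\<^sup>2 / v i)"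
  unfolding tilt_exponent_def score_pairing_def sum_distrib_left sum_subtractf[symmetric]
  using assms
  by (intro sum.cong) (auto simp: norm_mult power_mult_distrib add_divide_distrib diff_divide_distrib algebra_simps)

lemma measurable_linear_model:
  assumes "X \<in> carrier_mat m n" and H: "H \<in> measurable Q (mat_borel n K)" and V: "V \<in> measurable Q (mat_borel m K)"
  shows "(\<lambda>w. X * H w + V w) \<in> measurable Q (mat_borel m K)"
proof -
  have HV: "H w \<in> carrier_mat n K" "V w \<in> carrier_mat m K" if "w \<in> space Q" for w
    using measurable_space[OF H that] measurable_space[OF V that] by auto
  have entries: "l < n \<Longrightarrow> j < K \<Longrightarrow> (\<lambda>w. H w $$ (l, j)) \<in> borel_measurable Q"
    "i < m \<Longrightarrow> j < K \<Longrightarrow> (\<lambda>w. V w $$ (i, j)) \<in> borel_measurable Q" for l i j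
    using H V unfolding measurable_mat_borel_iff by auto
  have entry: "(X * H w + V w) $$ (i, j) = (\<Sum>l<n. X $$ (i, l) * H w $$ (l, j)) + V w $$ (i, j)"
    if "w \<in> space Q" "i < m" "j < K" for w i j
    using HV[OF that(1)] assms(1) that by (auto simp: scalar_prod_def atLeast0LessThan)
  show ?thesis
    unfolding measurable_mat_borel_iff
  proof (intro conjI allI impI)
    show "(\<lambda>w. X * H w + V w) \<in> space Q \<rightarrow> carrier_mat m K" using HV assms(1) by auto
    fix i j assume "i < m" "j < K"
    then show "(\<lambda>w. (X * H w + V w) $$ (i, j)) \<in> borel_measurable Q"
      by (subst measurable_cong[OF entry]) (auto intro!: borel_measurable_add borel_measurable_sum borel_measurable_times entries)
  qed
qed

text \<open>Entry \<open>(j, k)\<close> of $X^H \Sigma^{-1} V - \Psi^{-1} H$ at \<open>H = h\<close> and \<open>V = a\<close>.\<close>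

definition score :: "nat \<Rightarrow> (nat \<Rightarrow> real) \<Rightarrow> (nat \<Rightarrow> real) \<Rightarrow> complex mat \<Rightarrow> complex mat \<Rightarrow> complex mat \<Rightarrow> nat \<Rightarrow> nat \<Rightarrow> complex" where
  "score m \<psi> v X h a j k = (\<Sum>i<m. cnj (X $$ (i, j)) * a $$ (i, k) / v i) - h $$ (j, k) / \<psi> j"

text \<open>A direction supported on one entry extracts that entry of the score:
  \<open>c = 1\<close> yields its real part and \<open>c = \<i>\<close> its imaginary part.\<close>

lemma score_pairing_single:
  fixes c :: complex
  assumes X: "X \<in> carrier_mat m n" and jk: "j < n" "k < K"
  defines "U \<equiv> mat n K (\<lambda>p. if p = (j, k) then c else 0)"
  shows "score_pairing m K v (X * U) a - score_pairing n K \<psi> U h = Re (cnj c * score m \<psi> v X h a j k)"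
proof -
  have Re_scale: "Re (cnj (x * c) * a) / r = Re (cnj c * (cnj x * a / of_real r))" for x a :: complex and r
    unfolding Re_divide_of_real[symmetric] by (simp add: mult_ac)
  have XU: "(X * U) $$ (i, b) = (if b = k then X $$ (i, j) * c else 0)" if "i < m" "b < K" for i b
  proof -
    have "(X * U) $$ (i, b) = (\<Sum>l<n. X $$ (i, l) * (if l = j \<and> b = k then c else 0))"
      using X that by (auto simp: U_def scalar_prod_def atLeast0LessThan intro!: sum.cong)
    also have "\<dots> = (\<Sum>l<n. if l = j then X $$ (i, l) * (if b = k then c else 0) else 0)"
      by (intro sum.cong) auto
    finally show ?thesis using jk by simp
  qed
  have "score_pairing m K v (X * U) a = (\<Sum>i<m. \<Sum>b<K. if b = k then Re (cnj (X $$ (i, j) * c) * a $$ (i, b)) / v i else 0)"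
    unfolding score_pairing_def sum.cartesian_product[symmetric]
    by (intro sum.cong) (auto simp: XU algebra_simps)
  also have "\<dots> = Re (cnj c * (\<Sum>i<m. cnj (X $$ (i, j)) * a $$ (i, k) / v i))"
    using jk by (simp only: sum.delta finite_lessThan lessThan_iff if_True Re_scale sum_distrib_left Re_sum)
  finally have 1: "score_pairing m K v (X * U) a = \<dots>" .
  have "score_pairing n K \<psi> U h = (\<Sum>i<n. \<Sum>b<K. if b = k then (if i = j then Re (cnj c * h $$ (i, b)) / \<psi> i else 0) else 0)"
    unfolding score_pairing_def sum.cartesian_product[symmetric]
    by (intro sum.cong) (auto simp: U_def)
  also have "\<dots> = Re (cnj c * (h $$ (j, k) / \<psi> j))"
    using jk by (simp add: Re_scale[of 1, simplified])
  finally show ?thesis unfolding 1 by (simp add: score_def right_diff_distrib)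
qed

section \<open>The linear Gaussian model with noise variances depending on the row\<close>

locale linear_gaussian_model = prob_space P for P :: "'w measure" +
  fixes n m K :: nat and \<psi> v :: "nat \<Rightarrow> real" and X :: "complex mat" and H V :: "'w \<Rightarrow> complex mat"
  assumes pos: "n > 0" "m > 0" "K > 0" "\<forall>i<n. \<psi> i > 0" "\<forall>i<m. v i > 0"
    and H: "indep_cn_entries P n K \<psi> H" and V: "indep_cn_entries P m K v V"
    and indep: "indep_var (mat_borel n K) H (mat_borel m K) V"
    and X: "X \<in> carrier_mat m n"
begin

lemma measurable_signal [measurable]: "H \<in> measurable P (mat_borel n K)"
  and measurable_noise [measurable]: "V \<in> measurable P (mat_borel m K)"
  using H V unfolding indep_cn_entries_def by auto

text \<open>The joint law is a product by independence, so the shift of \<open>(H, V)\<close> by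
  \<open>(U, - (X * U))\<close> is carried out in iterated integrals: first the noise at a fixed
  signal, then the signal.\<close>

lemma nn_integral_observation_tilt:
  assumes U: "U \<in> carrier_mat n K"
    and G [measurable]: "G \<in> borel_measurable (mat_borel m K)"
  shows "(\<integral>\<^sup>+w. G (X * H w + V w) \<partial>P) =
    (\<integral>\<^sup>+w. ennreal (exp (tilt_exponent n K \<psi> U (H w) + tilt_exponent m K v (- (X * U)) (V w))) * G (X * H w + V w) \<partial>P)"
proof -
  define D1 where "D1 = distr P (mat_borel n K) H"
  define D2 where "D2 = distr P (mat_borel m K) V"
  have sets [measurable_cong]: "sets D1 = sets (mat_borel n K)" "sets D2 = sets (mat_borel m K)"
    by (simp_all add: D1_def D2_def)
  have space: "space D1 = carrier_mat n K" "space D2 = carrier_mat m K"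
    by (simp_all add: D1_def D2_def)
  interpret D2: prob_space D2 unfolding D2_def by (rule prob_space_distr) measurable
  have pair: "distr P (mat_borel n K \<Otimes>\<^sub>M mat_borel m K) (\<lambda>w. (H w, V w)) = D1 \<Otimes>\<^sub>M D2"
    using indep unfolding indep_var_distribution_eq D1_def D2_def by simp
  let ?XU = "- (X * U)"
  have lin [measurable]: "(\<lambda>p. X * fst p + snd p) \<in> measurable (D1 \<Otimes>\<^sub>M D2) (mat_borel m K)"
    by (rule measurable_linear_model[OF X]) measurable
  have plusU [measurable]: "(\<lambda>p. X * fst p + (snd p + ?XU)) \<in> measurable (D1 \<Otimes>\<^sub>M D2) (mat_borel m K)"
  proof (rule measurable_linear_model[OF X])
    \<comment> \<open>The identity matrix is inserted to make the translation an instance of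
      \<open>measurable_linear_model\<close>.\<close>
    have "(\<lambda>p. 1\<^sub>m m * snd p + ?XU) \<in> measurable (D1 \<Otimes>\<^sub>M D2) (mat_borel m K)"
    proof (rule measurable_linear_model)
      show "(\<lambda>p. ?XU) \<in> measurable (D1 \<Otimes>\<^sub>M D2) (mat_borel m K)"
        using X U by (auto simp: measurable_mat_borel_iff)
    qed auto
    then show "(\<lambda>p. snd p + ?XU) \<in> measurable (D1 \<Otimes>\<^sub>M D2) (mat_borel m K)"
      by (rule measurable_cong[THEN iffD1, rotated]) (auto simp: space_pair_measure space)
  qed measurable
  have XA [measurable]: "(\<lambda>a. X * h + a) \<in> measurable (mat_borel m K) (mat_borel m K)" if "h \<in> carrier_mat n K" for h
    by (rule measurable_linear_model[OF X]) (use that in \<open>auto simp: measurable_mat_borel_iff\<close>)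
  have pairP: "(\<integral>\<^sup>+w. F (H w, V w) \<partial>P) = (\<integral>\<^sup>+h. \<integral>\<^sup>+a. F (h, a) \<partial>D2 \<partial>D1)"
    if "F \<in> borel_measurable (D1 \<Otimes>\<^sub>M D2)" for F :: "complex mat \<times> complex mat \<Rightarrow> ennreal"
  proof -
    have "F \<in> borel_measurable (mat_borel n K \<Otimes>\<^sub>M mat_borel m K)"
      using that by (simp cong: measurable_cong_sets add: sets_pair_measure_cong[OF sets])
    then have "(\<integral>\<^sup>+w. F (H w, V w) \<partial>P) = (\<integral>\<^sup>+p. F p \<partial>distr P (mat_borel n K \<Otimes>\<^sub>M mat_borel m K) (\<lambda>w. (H w, V w)))"
      by (intro nn_integral_distr[symmetric]) auto
    also have "\<dots> = (\<integral>\<^sup>+h. \<integral>\<^sup>+a. F (h, a) \<partial>D2 \<partial>D1)"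
      unfolding pair by (rule D2.nn_integral_fst[symmetric]) fact
    finally show ?thesis .
  qed
  have "(\<integral>\<^sup>+w. G (X * H w + V w) \<partial>P) = (\<integral>\<^sup>+h. \<integral>\<^sup>+a. G (X * h + a) \<partial>D2 \<partial>D1)"
    using pairP[of "\<lambda>p. G (X * fst p + snd p)"] by simp
  also have "\<dots> = (\<integral>\<^sup>+h. \<integral>\<^sup>+a. ennreal (exp (tilt_exponent m K v ?XU a)) * G (X * h + (a + ?XU)) \<partial>D2 \<partial>D1)"
  proof (rule nn_integral_cong)
    fix h assume "h \<in> space D1"
    then have [simp]: "h \<in> carrier_mat n K" by (simp add: space)
    show "(\<integral>\<^sup>+a. G (X * h + a) \<partial>D2) =
      (\<integral>\<^sup>+a. ennreal (exp (tilt_exponent m K v ?XU a)) * G (X * h + (a + ?XU)) \<partial>D2)"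
      unfolding D2_def
      by (rule nn_integral_indep_cn_entries_shift[OF prob_space_axioms V]) (use pos X U in auto)
  qed
  \<comment> \<open>The second shift is applied to the inner integral as a function of the signal,
    whose measurability has to be checked first.\<close>
  also have "\<dots> = (\<integral>\<^sup>+h. ennreal (exp (tilt_exponent n K \<psi> U h)) *
      (\<integral>\<^sup>+a. ennreal (exp (tilt_exponent m K v ?XU a)) * G (X * (h + U) + (a + ?XU)) \<partial>D2) \<partial>D1)"
  proof -
    have "(\<lambda>h. \<integral>\<^sup>+a. ennreal (exp (tilt_exponent m K v ?XU a)) * G (X * h + (a + ?XU)) \<partial>D2) \<in> borel_measurable D1"
      by (rule D2.borel_measurable_nn_integral) (simp add: split_beta)
    then show ?thesis
      unfolding D1_def
      by (intro nn_integral_indep_cn_entries_shift[OF prob_space_axioms H]) (use pos U in auto)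
  qed
  also have "\<dots> = (\<integral>\<^sup>+h. \<integral>\<^sup>+a. ennreal (exp (tilt_exponent n K \<psi> U h + tilt_exponent m K v ?XU a)) * G (X * h + a) \<partial>D2 \<partial>D1)"
  proof (rule nn_integral_cong)
    fix h assume "h \<in> space D1"
    then have h [simp]: "h \<in> carrier_mat n K" by (simp add: space)
    \<comment> \<open>The two shifts cancel, so \<open>G\<close> sees the original observation and
      only the weights remain.\<close>
    have "X * (h + U) + (a + ?XU) = X * h + a" if "a \<in> carrier_mat m K" for a
      using that X U h by (auto intro!: eq_matI simp: mult_add_distrib_mat[OF X h U])
    then have "(\<integral>\<^sup>+a. ennreal (exp (tilt_exponent m K v ?XU a)) * G (X * (h + U) + (a + ?XU)) \<partial>D2) =
      (\<integral>\<^sup>+a. ennreal (exp (tilt_exponent m K v ?XU a)) * G (X * h + a) \<partial>D2)"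
      by (intro nn_integral_cong) (simp add: space)
    then show "ennreal (exp (tilt_exponent n K \<psi> U h)) *
      (\<integral>\<^sup>+a. ennreal (exp (tilt_exponent m K v ?XU a)) * G (X * (h + U) + (a + ?XU)) \<partial>D2) =
      (\<integral>\<^sup>+a. ennreal (exp (tilt_exponent n K \<psi> U h + tilt_exponent m K v ?XU a)) * G (X * h + a) \<partial>D2)"
      by (simp add: nn_integral_cmult[symmetric] exp_add ennreal_mult' mult.assoc)
  qed
  also have "\<dots> = (\<integral>\<^sup>+w. ennreal (exp (tilt_exponent n K \<psi> U (H w) + tilt_exponent m K v ?XU (V w))) * G (X * H w + V w) \<partial>P)"
    using pairP[of "\<lambda>p. ennreal (exp (tilt_exponent n K \<psi> U (fst p) + tilt_exponent m K v ?XU (snd p))) * G (X * fst p + snd p)"]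
    by simp
  finally show ?thesis .
qed

lemma integral_observation_score_pairing:
  fixes G :: "complex mat \<Rightarrow> real"
  assumes U: "U \<in> carrier_mat n K"
    and G [measurable]: "G \<in> borel_measurable (mat_borel m K)" and int: "integrable P (\<lambda>w. G (X * H w + V w))"
  defines "s \<equiv> \<lambda>w. score_pairing m K v (X * U) (V w) - score_pairing n K \<psi> U (H w)"
  shows "integrable P (\<lambda>w. G (X * H w + V w) * s w)" "(\<integral>w. G (X * H w + V w) * s w \<partial>P) = 0"
proof -
  have s [measurable]: "s \<in> borel_measurable P" unfolding s_def by measurable
  define c where "c = (\<Sum>(i, j)\<in>{..<n} \<times> {..<K}. (cmod (U $$ (i, j)))\<^sup>2 / \<psi> i) +
    (\<Sum>(i, j)\<in>{..<m} \<times> {..<K}. (cmod ((X * U) $$ (i, j)))\<^sup>2 / v i)"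
  have "(\<integral>\<^sup>+w. ennreal (f (G (X * H w + V w))) \<partial>P) =
      (\<integral>\<^sup>+w. ennreal (f (G (X * H w + V w)) * exp (2 * t * s w - t\<^sup>2 * c)) \<partial>P)"
    if [measurable]: "f \<in> borel_measurable borel" and f0: "\<And>x. f x \<ge> 0" for f :: "real \<Rightarrow> real" and t
  proof -
    have tU: "complex_of_real t \<cdot>\<^sub>m U \<in> carrier_mat n K" and XU: "X * U \<in> carrier_mat m K" using U X by auto
    have "- (X * (complex_of_real t \<cdot>\<^sub>m U)) = complex_of_real (- t) \<cdot>\<^sub>m (X * U)"
      using X U by (auto intro!: eq_matI)
    \<comment> \<open>Along \<open>t * U\<close> both exponents are quadratic polynomials in
      \<open>t\<close>. The linear parts add up to \<open>2 * t * s w\<close>; the quadratic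
      coefficients are deterministic and add up to \<open>- c\<close>.\<close>
    then have e: "tilt_exponent n K \<psi> (complex_of_real t \<cdot>\<^sub>m U) (H w) +
        tilt_exponent m K v (- (X * (complex_of_real t \<cdot>\<^sub>m U))) (V w) = 2 * t * s w - t\<^sup>2 * c" for w
      by (simp only: tilt_exponent_smult[OF U] tilt_exponent_smult[OF XU] s_def c_def) (simp add: algebra_simps)
    have "(\<lambda>y. ennreal (f (G y))) \<in> borel_measurable (mat_borel m K)" by measurable
    from nn_integral_observation_tilt[OF tU this] show ?thesis
      by (simp only: e mult.commute[of "ennreal (exp _)"] ennreal_mult'[OF f0, symmetric])
  qed
  note vanish = integral_score_eq_0[OF int s this]
  show "integrable P (\<lambda>w. G (X * H w + V w) * s w)" "(\<integral>w. G (X * H w + V w) * s w \<partial>P) = 0"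
    by (rule vanish; assumption)+
qed

text \<open>The real orthogonality is applied to the real and imaginary parts of \<open>G\<close> in
  the directions \<open>c = 1\<close> and \<open>c = \<i>\<close>. These four real integrals are the
  components of the complex one.\<close>

lemma integral_observation_score:
  fixes G :: "complex mat \<Rightarrow> complex"
  assumes jk: "j < n" "k < K"
    and G [measurable]: "G \<in> borel_measurable (mat_borel m K)" and int: "integrable P (\<lambda>w. G (X * H w + V w))"
  defines "s \<equiv> \<lambda>w. score m \<psi> v X (H w) (V w) j k"
  shows "integrable P (\<lambda>w. G (X * H w + V w) * cnj (s w))" "(\<integral>w. G (X * H w + V w) * cnj (s w) \<partial>P) = 0"
proof -
  let ?U = "\<lambda>c. mat n K (\<lambda>p. if p = (j, k) then c else 0)"
  let ?Y = "\<lambda>w. X * H w + V w"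
  have U: "?U c \<in> carrier_mat n K" for c by simp
  note * = integral_observation_score_pairing[OF U, unfolded score_pairing_single[OF X jk], folded s_def]
  have ReG: "(\<lambda>a. Re (G a)) \<in> borel_measurable (mat_borel m K)" "integrable P (\<lambda>w. Re (G (?Y w)))"
    and ImG: "(\<lambda>a. Im (G a)) \<in> borel_measurable (mat_borel m K)" "integrable P (\<lambda>w. Im (G (?Y w)))"
    using int by auto
  have RR: "integrable P (\<lambda>w. Re (G (?Y w)) * Re (s w))" "(\<integral>w. Re (G (?Y w)) * Re (s w) \<partial>P) = 0"
    and IR: "integrable P (\<lambda>w. Im (G (?Y w)) * Re (s w))" "(\<integral>w. Im (G (?Y w)) * Re (s w) \<partial>P) = 0"
    using *[OF ReG, of 1] *[OF ImG, of 1] by (simp_all add: s_def)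
  have RI: "integrable P (\<lambda>w. Re (G (?Y w)) * Im (s w))" "(\<integral>w. Re (G (?Y w)) * Im (s w) \<partial>P) = 0"
    and II: "integrable P (\<lambda>w. Im (G (?Y w)) * Im (s w))" "(\<integral>w. Im (G (?Y w)) * Im (s w) \<partial>P) = 0"
    using *[OF ReG, of \<i>] *[OF ImG, of \<i>] by (simp_all add: s_def)
  have eq: "(\<lambda>w. G (?Y w) * cnj (s w)) = (\<lambda>w. complex_of_real (Re (G (?Y w)) * Re (s w)) + complex_of_real (Im (G (?Y w)) * Im (s w))
    + \<i> * (complex_of_real (Im (G (?Y w)) * Re (s w)) - complex_of_real (Re (G (?Y w)) * Im (s w))))"
    by (auto simp: complex_eq_iff)
  have of_real: "integrable P f \<Longrightarrow> integrable P (\<lambda>w. complex_of_real (f w))" for f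
    by (rule integrable_of_real)
  note ints = RR(1)[THEN of_real] II(1)[THEN of_real] IR(1)[THEN of_real] RI(1)[THEN of_real]
  show "integrable P (\<lambda>w. G (?Y w) * cnj (s w))"
    unfolding eq using ints by (intro Bochner_Integration.integrable_add Bochner_Integration.integrable_diff integrable_mult_right) auto
  have "(\<integral>w. G (?Y w) * cnj (s w) \<partial>P) = (\<integral>w. complex_of_real (Re (G (?Y w)) * Re (s w)) \<partial>P)
     + (\<integral>w. complex_of_real (Im (G (?Y w)) * Im (s w)) \<partial>P)
    + \<i> * ((\<integral>w. complex_of_real (Im (G (?Y w)) * Re (s w)) \<partial>P) - (\<integral>w. complex_of_real (Re (G (?Y w)) * Im (s w)) \<partial>P))"
    unfolding eq using ints by simp
  also have "\<dots> = 0" unfolding integral_complex_of_real using RR RI IR II by simp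
  finally show "(\<integral>w. G (?Y w) * cnj (s w) \<partial>P) = 0" .
qed

subsection \<open>The mean square error\<close>

lemma signal_moments:
  assumes "i < n" "k < K"
  shows "integrable P (\<lambda>w. H w $$ (i, k))" "expectation (\<lambda>w. H w $$ (i, k)) = 0"
    "integrable P (\<lambda>w. (cmod (H w $$ (i, k)))\<^sup>2)"
  using cn_moments(1-3)[of "\<psi> i" "\<lambda>w. H w $$ (i, k)"] H pos assms unfolding indep_cn_entries_def by auto

lemma noise_moments:
  assumes "l < m" "k < K"
  shows "integrable P (\<lambda>w. V w $$ (l, k))" "expectation (\<lambda>w. V w $$ (l, k)) = 0"
  using cn_moments(1,2)[of "v l" "\<lambda>w. V w $$ (l, k)"] V pos assms unfolding indep_cn_entries_def by auto

lemma signal_noise_uncorrelated: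
  assumes "i < n" "l < m" "k < K"
  shows "integrable P (\<lambda>w. H w $$ (i, k) * cnj (V w $$ (l, k)))"
    "expectation (\<lambda>w. H w $$ (i, k) * cnj (V w $$ (l, k))) = 0"
proof -
  have "indep_var borel (\<lambda>w. H w $$ (i, k)) borel (\<lambda>w. cnj (V w $$ (l, k)))"
    using indep_var_compose[OF indep, of "\<lambda>A. A $$ (i, k)" borel "\<lambda>A. cnj (A $$ (l, k))" borel] assms
    by (simp add: comp_def)
  from indep_var_integrable[OF this] indep_var_lebesgue_integral[OF this]
  show "integrable P (\<lambda>w. H w $$ (i, k) * cnj (V w $$ (l, k)))"
    "expectation (\<lambda>w. H w $$ (i, k) * cnj (V w $$ (l, k))) = 0"
    using signal_moments[of i k] noise_moments[of l k] assms by auto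
qed

text \<open>The noise part of the score averages to zero against the signal, by independence and
  centring. The prior part leaves \<open>- \<psi> j / \<psi> j\<close> for \<open>i = j\<close> and
  zero otherwise.\<close>

lemma signal_score:
  assumes "i < n" "j < n" "k < K"
  shows "integrable P (\<lambda>w. H w $$ (i, k) * cnj (score m \<psi> v X (H w) (V w) j k))"
    "expectation (\<lambda>w. H w $$ (i, k) * cnj (score m \<psi> v X (H w) (V w) j k)) = (if i = j then - 1 else 0)"
proof -
  have eq: "H w $$ (i, k) * cnj (score m \<psi> v X (H w) (V w) j k) =
    (\<Sum>l<m. X $$ (l, j) / v l * (H w $$ (i, k) * cnj (V w $$ (l, k)))) - (1 / \<psi> j) * (H w $$ (i, k) * cnj (H w $$ (j, k)))" for w
    by (simp add: score_def right_diff_distrib sum_distrib_left mult_ac)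
  note HH = indep_cn_entries_covariance[OF H pos(4) assms]
  show "integrable P (\<lambda>w. H w $$ (i, k) * cnj (score m \<psi> v X (H w) (V w) j k))"
    unfolding eq
    by (intro Bochner_Integration.integrable_diff Bochner_Integration.integrable_sum integrable_mult_right)
       (use HH signal_noise_uncorrelated assms in auto)
  have "expectation (\<lambda>w. H w $$ (i, k) * cnj (score m \<psi> v X (H w) (V w) j k)) =
    (\<Sum>l<m. X $$ (l, j) / v l * expectation (\<lambda>w. H w $$ (i, k) * cnj (V w $$ (l, k)))) -
    (1 / \<psi> j) * expectation (\<lambda>w. H w $$ (i, k) * cnj (H w $$ (j, k)))"
    unfolding eq
    by (subst Bochner_Integration.integral_diff)
       (use HH signal_noise_uncorrelated assms in \<open>auto intro!: Bochner_Integration.integrable_sum\<close>)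
  also have "\<dots> = (if i = j then - 1 else 0)"
    using HH signal_noise_uncorrelated assms pos by auto
  finally show "expectation (\<lambda>w. H w $$ (i, k) * cnj (score m \<psi> v X (H w) (V w) j k)) = (if i = j then - 1 else 0)" .
qed

text \<open>The Bayesian information matrix of one column of \<open>H\<close>: the Gram matrix of
  \<open>X\<close> weighted by the inverse noise covariance, plus the inverse prior covariance. It
  is the same for every column.\<close>

definition information :: "complex mat" where
  "information = mat n n (\<lambda>(i, j). (\<Sum>l<m. cnj (X $$ (l, i)) * X $$ (l, j) / v l) + (if i = j then 1 / \<psi> i else 0))"

lemma information_carrier: "information \<in> carrier_mat n n"
  by (simp add: information_def)

text \<open>Substituting \<open>V = Y - X H\<close> splits the score into a linear function of the
  observation minus \<open>information\<close> applied to the signal. An inverse of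
  \<open>information\<close> then isolates the signal.\<close>

lemma score_observation:
  assumes "j < n" "k < K" "h \<in> carrier_mat n K" "a \<in> carrier_mat m K"
  shows "score m \<psi> v X h a j k = (\<Sum>l<m. cnj (X $$ (l, j)) * (X * h + a) $$ (l, k) / v l)
    - (\<Sum>i<n. information $$ (j, i) * h $$ (i, k))"
proof -
  have Y: "(X * h + a) $$ (l, k) = (\<Sum>i<n. X $$ (l, i) * h $$ (i, k)) + a $$ (l, k)" if "l < m" for l
    using X assms that by (simp add: scalar_prod_def atLeast0LessThan)
  have "(\<Sum>l<m. cnj (X $$ (l, j)) * (X * h + a) $$ (l, k) / v l) =
    (\<Sum>l<m. \<Sum>i<n. cnj (X $$ (l, j)) * X $$ (l, i) / v l * h $$ (i, k)) + (\<Sum>l<m. cnj (X $$ (l, j)) * a $$ (l, k) / v l)"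
    unfolding sum.distrib[symmetric]
    by (intro sum.cong) (auto simp: Y distrib_left sum_distrib_left add_divide_distrib sum_divide_distrib mult_ac)
  moreover have "(\<Sum>i<n. information $$ (j, i) * h $$ (i, k)) =
    (\<Sum>l<m. \<Sum>i<n. cnj (X $$ (l, j)) * X $$ (l, i) / v l * h $$ (i, k)) + h $$ (j, k) / \<psi> j"
  proof -
    have "(\<Sum>i<n. information $$ (j, i) * h $$ (i, k)) = (\<Sum>i<n. (\<Sum>l<m. cnj (X $$ (l, j)) * X $$ (l, i) / v l * h $$ (i, k))
      + (if i = j then h $$ (i, k) / \<psi> j else 0))"
      using assms(1) by (intro sum.cong) (auto simp: information_def distrib_right sum_distrib_right)
    also have "\<dots> = (\<Sum>i<n. \<Sum>l<m. cnj (X $$ (l, j)) * X $$ (l, i) / v l * h $$ (i, k)) + h $$ (j, k) / \<psi> j"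
      using assms(1) by (simp add: sum.distrib)
    finally show ?thesis by (subst sum.swap)
  qed
  ultimately show ?thesis by (simp add: score_def)
qed

text \<open>The quadratic form of \<open>information\<close> at \<open>u\<close> is the weighted
  squared norm of \<open>z = X u\<close> plus that of \<open>u\<close> itself. On a kernel vector it
  is zero, and the positive prior weights then force \<open>u = 0\<close>.\<close>

lemma det_information: "det information \<noteq> 0"
proof
  assume "det information = 0"
  then obtain u where u: "u \<in> carrier_vec n" "u \<noteq> 0\<^sub>v n" "information *\<^sub>v u = 0\<^sub>v n"
    using det_0_iff_vec_prod_zero[OF information_carrier] by blast
  have row: "(\<Sum>l<m. cnj (X $$ (l, i)) * (\<Sum>j<n. X $$ (l, j) * u $ j) / v l) + u $ i / \<psi> i = 0" if "i < n" for i
  proof -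
    have "0 = (information *\<^sub>v u) $ i" using u that by simp
    also have "\<dots> = (\<Sum>j<n. information $$ (i, j) * u $ j)"
      using u(1) information_carrier that by (simp add: scalar_prod_def atLeast0LessThan)
    also have "\<dots> = (\<Sum>j<n. (\<Sum>l<m. cnj (X $$ (l, i)) * X $$ (l, j) / v l * u $ j) + (if j = i then u $ j / \<psi> i else 0))"
      using that by (intro sum.cong) (auto simp: information_def distrib_right sum_distrib_right)
    also have "\<dots> = (\<Sum>j<n. \<Sum>l<m. cnj (X $$ (l, i)) * X $$ (l, j) / v l * u $ j) + u $ i / \<psi> i"
      using that by (simp add: sum.distrib)
    also have "(\<Sum>j<n. \<Sum>l<m. cnj (X $$ (l, i)) * X $$ (l, j) / v l * u $ j) =
      (\<Sum>l<m. cnj (X $$ (l, i)) * (\<Sum>j<n. X $$ (l, j) * u $ j) / v l)"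
      by (subst sum.swap) (simp add: sum_distrib_left sum_divide_distrib mult_ac)
    finally show ?thesis by simp
  qed
  define z where "z l = (\<Sum>j<n. X $$ (l, j) * u $ j)" for l
  have cnj_z: "cnj (z l) = (\<Sum>i<n. cnj (u $ i) * cnj (X $$ (l, i)))" for l
    by (simp add: z_def mult.commute)
  have "0 = (\<Sum>i<n. cnj (u $ i) * ((\<Sum>l<m. cnj (X $$ (l, i)) * z l / v l) + u $ i / \<psi> i))"
    by (simp add: row[folded z_def])
  also have "\<dots> = (\<Sum>l<m. cnj (z l) * z l / v l) + (\<Sum>i<n. cnj (u $ i) * u $ i / \<psi> i)"
  proof -
    have "(\<Sum>i<n. \<Sum>l<m. cnj (u $ i) * (cnj (X $$ (l, i)) * z l / v l)) = (\<Sum>l<m. cnj (z l) * z l / v l)"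
      by (subst sum.swap) (simp add: cnj_z sum_distrib_left sum_divide_distrib mult_ac)
    then show ?thesis by (simp add: distrib_left sum.distrib sum_distrib_left)
  qed
  also have "\<dots> = complex_of_real ((\<Sum>l<m. (cmod (z l))\<^sup>2 / v l) + (\<Sum>i<n. (cmod (u $ i))\<^sup>2 / \<psi> i))"
    by (simp add: complex_norm_square mult.commute del: of_real_power)
  finally have "(\<Sum>l<m. (cmod (z l))\<^sup>2 / v l) + (\<Sum>i<n. (cmod (u $ i))\<^sup>2 / \<psi> i) = 0"
    by (metis of_real_eq_0_iff)
  moreover have "(\<Sum>l<m. (cmod (z l))\<^sup>2 / v l) \<ge> 0" using pos by (intro sum_nonneg) (auto intro!: divide_nonneg_pos)
  moreover have nonneg: "(cmod (u $ i))\<^sup>2 / \<psi> i \<ge> 0" if "i < n" for i using pos that by (auto intro!: divide_nonneg_pos)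
  moreover have "(\<Sum>i<n. (cmod (u $ i))\<^sup>2 / \<psi> i) \<ge> 0" by (intro sum_nonneg) (auto intro: nonneg)
  ultimately have "(\<Sum>i<n. (cmod (u $ i))\<^sup>2 / \<psi> i) = 0" by linarith
  then have "\<forall>i<n. (cmod (u $ i))\<^sup>2 / \<psi> i = 0"
    by (subst (asm) sum_nonneg_eq_0_iff) (auto intro: nonneg)
  then have "u $ i = 0" if "i < n" for i using pos that by force
  then have "u = 0\<^sub>v n" using u(1) by (auto intro!: eq_vecI)
  with u(2) show False by simp
qed

lemma mean_square_error_entry:
  fixes g :: "complex mat \<Rightarrow> complex"
  assumes C: "C \<in> carrier_mat n n" "C * information = 1\<^sub>m n" and ik: "i < n" "k < K"
    and g [measurable]: "g \<in> borel_measurable (mat_borel m K)"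
    and g2: "integrable P (\<lambda>w. (cmod (g (X * H w + V w)))\<^sup>2)"
  shows "integrable P (\<lambda>w. (cmod (g (X * H w + V w) - H w $$ (i, k)))\<^sup>2)"
    "Im (C $$ (i, i)) = 0"
    "expectation (\<lambda>w. (cmod (g (X * H w + V w) - H w $$ (i, k)))\<^sup>2) \<ge> Re (C $$ (i, i))"
proof -
  let ?Y = "\<lambda>w. X * H w + V w"
  let ?S = "\<lambda>w j. score m \<psi> v X (H w) (V w) j k"
  have Y [measurable]: "?Y \<in> measurable P (mat_borel m K)"
    by (rule measurable_linear_model[OF X]) measurable
  have Hik [measurable]: "(\<lambda>w. H w $$ (i, k)) \<in> borel_measurable P"
    using signal_moments(1)[OF ik] by simp
  \<comment> \<open>\<open>W\<close> is the linear estimator of entry \<open>(i, k)\<close> and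
    \<open>e\<close> turns out to be its error. By \<open>orth\<close> below, \<open>W\<close> is
    the conditional mean of that entry given the observation.\<close>
  define W where "W y = (\<Sum>j<n. C $$ (i, j) * (\<Sum>l<m. cnj (X $$ (l, j)) * y $$ (l, k) / v l))" for y
  define e where "e w = (\<Sum>j<n. C $$ (i, j) * ?S w j)" for w
  have W [measurable]: "W \<in> borel_measurable (mat_borel m K)"
    unfolding W_def using ik by (intro borel_measurable_sum borel_measurable_times borel_measurable_divide) auto
  \<comment> \<open>In \<open>score_observation\<close> the signal enters \<open>e\<close> through
    \<open>C * information\<close>, the identity, so only the entry \<open>(i, k)\<close>
    survives.\<close>
  have e_eq: "e w = W (?Y w) - H w $$ (i, k)" if w: "w \<in> space P" for w
  proof -
    have hv: "H w \<in> carrier_mat n K" "V w \<in> carrier_mat m K"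
      using measurable_space[OF measurable_signal w] measurable_space[OF measurable_noise w] by auto
    have CI: "(\<Sum>j<n. C $$ (i, j) * information $$ (j, l)) = (if i = l then 1 else 0)" if "l < n" for l
    proof -
      have "(C * information) $$ (i, l) = (\<Sum>j<n. C $$ (i, j) * information $$ (j, l))"
        using C(1) information_carrier that ik by (simp add: scalar_prod_def atLeast0LessThan)
      then show ?thesis using C(2) that ik by simp
    qed
    have "(\<Sum>j<n. C $$ (i, j) * (\<Sum>l<n. information $$ (j, l) * H w $$ (l, k))) =
      (\<Sum>l<n. (\<Sum>j<n. C $$ (i, j) * information $$ (j, l)) * H w $$ (l, k))"
      unfolding sum_distrib_left sum_distrib_right mult.assoc by (rule sum.swap)
    also have "\<dots> = (\<Sum>l<n. if l = i then H w $$ (l, k) else 0)"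
      by (intro sum.cong) (auto simp: CI)
    also have "\<dots> = H w $$ (i, k)" using ik by simp
    finally show ?thesis
      unfolding e_def W_def using ik hv
      by (simp add: score_observation right_diff_distrib sum_subtractf)
  qed
  have e_m [measurable]: "e \<in> borel_measurable P"
    by (subst measurable_cong[OF e_eq]) measurable
  have orth: "integrable P (\<lambda>w. f (?Y w) * cnj (e w))" "expectation (\<lambda>w. f (?Y w) * cnj (e w)) = 0"
    if "f \<in> borel_measurable (mat_borel m K)" "integrable P (\<lambda>w. f (?Y w))" for f
  proof -
    have eq: "f (?Y w) * cnj (e w) = (\<Sum>j<n. cnj (C $$ (i, j)) * (f (?Y w) * cnj (?S w j)))" for w
      unfolding e_def by (simp add: sum_distrib_left mult_ac)
    note I = integral_observation_score[OF _ ik(2) that]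
    show "integrable P (\<lambda>w. f (?Y w) * cnj (e w))"
      unfolding eq using I(1) by (intro Bochner_Integration.integrable_sum integrable_mult_right) auto
    show "expectation (\<lambda>w. f (?Y w) * cnj (e w)) = 0"
      unfolding eq using I by simp
  qed
  \<comment> \<open>By \<open>signal_score\<close> only the summand \<open>j = i\<close> remains;
    \<open>C\<close> appears conjugated because \<open>e\<close> does.\<close>
  have He: "integrable P (\<lambda>w. H w $$ (i, k) * cnj (e w))" "expectation (\<lambda>w. H w $$ (i, k) * cnj (e w)) = - cnj (C $$ (i, i))"
  proof -
    have eq: "H w $$ (i, k) * cnj (e w) = (\<Sum>j<n. cnj (C $$ (i, j)) * (H w $$ (i, k) * cnj (?S w j)))" for w
      unfolding e_def by (simp add: sum_distrib_left mult_ac)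
    note I = signal_score[OF ik(1) _ ik(2)]
    show "integrable P (\<lambda>w. H w $$ (i, k) * cnj (e w))"
      unfolding eq using I(1) by (intro Bochner_Integration.integrable_sum integrable_mult_right) auto
    have "expectation (\<lambda>w. H w $$ (i, k) * cnj (e w)) = (\<Sum>j<n. cnj (C $$ (i, j)) * (if i = j then - 1 else 0))"
      unfolding eq using I by simp
    also have "\<dots> = (\<Sum>j<n. if j = i then - cnj (C $$ (i, j)) else 0)"
      by (intro sum.cong) auto
    finally show "expectation (\<lambda>w. H w $$ (i, k) * cnj (e w)) = - cnj (C $$ (i, i))"
      using ik by simp
  qed
  have Yint: "integrable P (\<lambda>w. ?Y w $$ (l, k))" if l: "l < m" for l
  proof -
    have "integrable P (\<lambda>w. (\<Sum>j<n. X $$ (l, j) * H w $$ (j, k)) + V w $$ (l, k))"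
      using signal_moments(1) noise_moments(1) l ik
      by (intro Bochner_Integration.integrable_add Bochner_Integration.integrable_sum integrable_mult_right) auto
    moreover have "?Y w $$ (l, k) = (\<Sum>j<n. X $$ (l, j) * H w $$ (j, k)) + V w $$ (l, k)" if w: "w \<in> space P" for w
      using X l ik measurable_space[OF measurable_signal w] measurable_space[OF measurable_noise w]
      by (simp add: scalar_prod_def atLeast0LessThan)
    ultimately show ?thesis by (simp cong: Bochner_Integration.integrable_cong)
  qed
  have Wint: "integrable P (\<lambda>w. W (?Y w))"
    unfolding W_def using Yint
    by (intro Bochner_Integration.integrable_sum integrable_mult_right integrable_divide) auto
  \<comment> \<open>One factor \<open>e\<close> is rewritten as estimator minus signal. The
    estimator is a function of the observation, so its term vanishes by \<open>orth\<close>.\<close>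
  have ee: "integrable P (\<lambda>w. e w * cnj (e w))" "expectation (\<lambda>w. e w * cnj (e w)) = cnj (C $$ (i, i))"
  proof -
    have eq: "e w * cnj (e w) = W (?Y w) * cnj (e w) - H w $$ (i, k) * cnj (e w)" if "w \<in> space P" for w
      using e_eq[OF that] by (metis left_diff_distrib)
    show "integrable P (\<lambda>w. e w * cnj (e w))"
      using Bochner_Integration.integrable_diff[OF orth(1)[OF W Wint] He(1)]
      by (simp add: eq cong: Bochner_Integration.integrable_cong)
    show "expectation (\<lambda>w. e w * cnj (e w)) = cnj (C $$ (i, i))"
      using Bochner_Integration.integral_diff[OF orth(1)[OF W Wint] He(1)] orth(2)[OF W Wint] He(2)
      by (simp add: eq cong: Bochner_Integration.integral_cong)
  qed
  have e2: "integrable P (\<lambda>w. (cmod (e w))\<^sup>2)" "complex_of_real (expectation (\<lambda>w. (cmod (e w))\<^sup>2)) = cnj (C $$ (i, i))"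
  proof -
    have Re: "(cmod (e w))\<^sup>2 = Re (e w * cnj (e w))" for w
      unfolding cmod_power2 by (simp add: power2_eq_square)
    show "integrable P (\<lambda>w. (cmod (e w))\<^sup>2)" unfolding Re by (rule integrable_Re) (rule ee)
    show "complex_of_real (expectation (\<lambda>w. (cmod (e w))\<^sup>2)) = cnj (C $$ (i, i))"
      unfolding integral_complex_of_real[symmetric] complex_norm_square using ee by simp
  qed
  \<comment> \<open>The conjugated diagonal entry equals a real mean. The comparison with the trace
    in the complex order rests on this.\<close>
  show "Im (C $$ (i, i)) = 0"
    using arg_cong[OF e2(2), of Im] by simp
  \<comment> \<open>Orthogonality asks for a first moment, which on a probability space follows from
    the second.\<close>
  have gint: "integrable P (\<lambda>w. g (?Y w))"
  proof (rule integrable_norm_cancel)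
    show "integrable P (\<lambda>w. norm (g (?Y w)))"
      by (rule square_integrable_imp_integrable) (use g2 in auto)
  qed measurable
  let ?d = "\<lambda>w. g (?Y w) - H w $$ (i, k)"
  show d2: "integrable P (\<lambda>w. (cmod (?d w))\<^sup>2)"
  proof (rule Bochner_Integration.integrable_bound)
    show "integrable P (\<lambda>w. 2 * (cmod (g (?Y w)))\<^sup>2 + 2 * (cmod (H w $$ (i, k)))\<^sup>2)"
      using g2 signal_moments(3)[OF ik] by (intro Bochner_Integration.integrable_add integrable_mult_right) auto
    have "(cmod (a - b))\<^sup>2 \<le> 2 * (cmod a)\<^sup>2 + 2 * (cmod b)\<^sup>2" for a b
      using power_mono[OF norm_triangle_ineq4[of a b], of 2] sum_squares_bound[of "cmod a" "cmod b"]
      by (simp add: power2_sum)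
    then show "AE w in P. norm ((cmod (?d w))\<^sup>2) \<le> norm (2 * (cmod (g (?Y w)))\<^sup>2 + 2 * (cmod (H w $$ (i, k)))\<^sup>2)"
      by simp
  qed measurable
  \<comment> \<open>The competing estimator vanishes against \<open>e\<close>, so its error
    \<open>?d\<close> pairs with \<open>e\<close> exactly as \<open>e\<close> does with
    itself.\<close>
  have de: "integrable P (\<lambda>w. ?d w * cnj (e w))" "expectation (\<lambda>w. ?d w * cnj (e w)) = cnj (C $$ (i, i))"
    unfolding left_diff_distrib using orth[OF g gint] He by simp_all
  have "Re (C $$ (i, i)) = 2 * Re (expectation (\<lambda>w. ?d w * cnj (e w))) - expectation (\<lambda>w. (cmod (e w))\<^sup>2)"
    using arg_cong[OF e2(2), of Re] by (simp add: de)
  also have "\<dots> = expectation (\<lambda>w. 2 * Re (?d w * cnj (e w)) - (cmod (e w))\<^sup>2)"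
    using integrable_Re[OF de(1)] e2(1) by (simp add: integral_Re[OF de(1), symmetric] del: times_complex.sel)
  also have "\<dots> \<le> expectation (\<lambda>w. (cmod (?d w))\<^sup>2)"
  proof (rule integral_mono)
    show "integrable P (\<lambda>w. 2 * Re (?d w * cnj (e w)) - (cmod (e w))\<^sup>2)"
      using integrable_Re[OF de(1)] e2(1) by (intro Bochner_Integration.integrable_diff integrable_mult_right)
    \<comment> \<open>The slack is the squared modulus of \<open>?d w - e w\<close>, the squared
      distance between the competing estimator and \<open>W\<close>.\<close>
    have eq: "2 * Re (a * cnj b) - (cmod b)\<^sup>2 = (cmod a)\<^sup>2 - (cmod (a - b))\<^sup>2" for a b
      unfolding cmod_power2 by (simp add: power2_eq_square algebra_simps)
    show "2 * Re (?d w * cnj (e w)) - (cmod (e w))\<^sup>2 \<le> (cmod (?d w))\<^sup>2" for w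
      unfolding eq by simp
  qed (rule d2)
  finally show "expectation (\<lambda>w. (cmod (?d w))\<^sup>2) \<ge> Re (C $$ (i, i))" .
qed

end

text \<open>Both sides decompose over the entries of \<open>H\<close>: the trace is \<open>K\<close>
  times that of the inverse \<open>C\<close> of \<open>information\<close>, and by
  \<open>mean_square_error_entry\<close> the error in entry \<open>(i, k)\<close> contributes at
  least the \<open>i\<close>-th diagonal entry of \<open>C\<close>.\<close>

theorem proposition1:
  fixes N M R K L :: nat
    and x :: "nat \<Rightarrow> nat \<Rightarrow> complex"
    and \<psi> :: "nat \<Rightarrow> real"
    and \<sigma> :: real
    and P :: "'w measure"
    and H V Y :: "'w \<Rightarrow> complex mat"
    and Hhat :: "complex mat \<Rightarrow> complex mat"
  defines "X \<equiv> observation_mat N M R L x"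
    and "\<Psi> \<equiv> mat_diag (N * M * R) (\<lambda>i. complex_of_real (\<psi> i))"
  assumes "N > 0" "M > 0" "R > 0" "K > 0" "L > 0"
    and "\<And>i. i < N * M * R \<Longrightarrow> \<psi> i > 0"
    and "\<sigma>\<^sup>2 > 0"
    and "prob_space P"
    and prior: "indep_cn_entries P (N * M * R) K \<psi> H"
    and noise: "indep_cn_entries P (M * (L + R - 1)) K (\<lambda>_. \<sigma>\<^sup>2) V"
    and indep: "prob_space.indep_var P (mat_borel (N * M * R) K) H (mat_borel (M * (L + R - 1)) K) V"
    and model: "\<And>w. w \<in> space P \<Longrightarrow> Y w = X * H w + V w"
    and estimator: "Hhat \<in> measurable (mat_borel (M * (L + R - 1)) K) (mat_borel (N * M * R) K)"
    and second_moment: "integrable P (\<lambda>w. (frobenius_norm (Hhat (Y w)))\<^sup>2)"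
    and unbiased: "mat_expectation P (N * M * R) K (\<lambda>w. Hhat (Y w) - H w) = 0\<^sub>m (N * M * R) K"
  shows "complex_of_real (\<integral>w. (frobenius_norm (Hhat (Y w) - H w))\<^sup>2 \<partial>P) \<ge>
    mat_trace (inv_mat
      ((complex_of_real (1 / \<sigma>\<^sup>2) \<cdot>\<^sub>m (mat_adjoint X * X)) \<otimes>\<^sub>m 1\<^sub>m K + inv_mat \<Psi> \<otimes>\<^sub>m 1\<^sub>m K))"
proof -
  interpret prob_space P by fact
  let ?n = "N * M * R" and ?m = "M * (L + R - 1)"
  have X: "X \<in> carrier_mat ?m ?n"
    unfolding X_def by (rule observation_mat_carrier)
  have psi: "\<psi> i > 0" if "i < ?n" for i using assms that by simp
  interpret linear_gaussian_model P ?n ?m K \<psi> "\<lambda>_. \<sigma>\<^sup>2" X H V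
    by unfold_locales (use assms X in auto)
  let ?B = "complex_of_real (1 / \<sigma>\<^sup>2) \<cdot>\<^sub>m (mat_adjoint X * X)"
  let ?D = "mat_diag ?n (\<lambda>i. complex_of_real (1 / \<psi> i))"
  have adj: "mat_adjoint X \<in> carrier_mat ?n ?m"
    using X by (auto simp: mat_adjoint_def)
  have inv_Psi: "inv_mat \<Psi> = ?D"
    unfolding \<Psi>_def by (subst inv_mat_diag) (use psi in force)+
  have carr: "?B \<in> carrier_mat ?n ?n" "?D \<in> carrier_mat ?n ?n" and I: "information \<in> carrier_mat ?n ?n"
    using X adj information_carrier by auto
  \<comment> \<open>The noise variance is the same in every row, so the weights in
    \<open>information\<close> come out of the Gram matrix as one scalar.\<close>
  have BD: "?B + ?D = information"
    using X adj by (intro eq_matI)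
      (auto simp: information_def mat_diag_def scalar_prod_def atLeast0LessThan mat_adjoint_index[OF X]
        sum_divide_distrib simp del: One_nat_def)
  obtain C where C: "C \<in> carrier_mat ?n ?n" "information * C = 1\<^sub>m ?n" "C * information = 1\<^sub>m ?n"
    using det_non_zero_imp_unit[OF I det_information, of "()"] by (auto simp: Units_def ring_mat_def)
  have "inv_mat (?B \<otimes>\<^sub>m 1\<^sub>m K + inv_mat \<Psi> \<otimes>\<^sub>m 1\<^sub>m K) = C \<otimes>\<^sub>m 1\<^sub>m K"
    unfolding inv_Psi kronecker_one_add[OF carr] BD by (rule inv_mat_kronecker_one[OF I C])
  then have tr: "mat_trace (inv_mat (?B \<otimes>\<^sub>m 1\<^sub>m K + inv_mat \<Psi> \<otimes>\<^sub>m 1\<^sub>m K)) = of_nat K * (\<Sum>i<?n. C $$ (i, i))"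
    by (simp add: mat_trace_kronecker_one[OF C(1)])
  let ?Z = "\<lambda>w. X * H w + V w"
  let ?g = "\<lambda>i k y. Hhat y $$ (i, k)"
  have Ym: "?Z \<in> measurable P (mat_borel ?m K)"
    by (rule measurable_linear_model[OF X]) measurable
  have Hhat_carrier: "Hhat y \<in> carrier_mat ?n K" if "y \<in> carrier_mat ?m K" for y
    using measurable_space[OF estimator] that by simp
  have g: "?g i k \<in> borel_measurable (mat_borel ?m K)" if "i < ?n" "k < K" for i k
    using estimator that unfolding measurable_mat_borel_iff by blast
  \<comment> \<open>A single entry is dominated by the Frobenius norm, which passes the finite
    second moment on to each entry.\<close>
  have g2: "integrable P (\<lambda>w. (cmod (?g i k (?Z w)))\<^sup>2)" if ik: "i < ?n" "k < K" for i k
  proof (rule Bochner_Integration.integrable_bound[OF second_moment])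
    show "(\<lambda>w. (cmod (?g i k (?Z w)))\<^sup>2) \<in> borel_measurable P"
      using measurable_compose[OF Ym g[OF ik]] by measurable
    show "AE w in P. norm ((cmod (?g i k (?Z w)))\<^sup>2) \<le> norm ((frobenius_norm (Hhat (Y w)))\<^sup>2)"
    proof (rule AE_I2)
      fix w assume w: "w \<in> space P"
      have "(cmod (?g i k (?Z w)))\<^sup>2 \<le> (\<Sum>b<K. (cmod (?g i b (?Z w)))\<^sup>2)"
        using ik by (intro member_le_sum) auto
      also have "\<dots> \<le> (\<Sum>a<?n. \<Sum>b<K. (cmod (?g a b (?Z w)))\<^sup>2)"
        using ik by (intro member_le_sum[of i]) (auto intro!: sum_nonneg)
      also have "\<dots> = (frobenius_norm (Hhat (Y w)))\<^sup>2"
        using measurable_space[OF Ym w] by (simp add: model[OF w] frobenius_norm_squared[OF Hhat_carrier])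
      finally show "norm ((cmod (?g i k (?Z w)))\<^sup>2) \<le> norm ((frobenius_norm (Hhat (Y w)))\<^sup>2)"
        by simp
    qed
  qed
  note mse = mean_square_error_entry[OF C(1,3) _ _ g g2]
  have "(\<integral>w. (frobenius_norm (Hhat (Y w) - H w))\<^sup>2 \<partial>P) =
    (\<integral>w. (\<Sum>i<?n. \<Sum>k<K. (cmod (?g i k (?Z w) - H w $$ (i, k)))\<^sup>2) \<partial>P)"
  proof (rule Bochner_Integration.integral_cong)
    fix w assume w: "w \<in> space P"
    have Hw: "H w \<in> carrier_mat ?n K" and hat: "Hhat (?Z w) \<in> carrier_mat ?n K"
      using measurable_space[OF measurable_signal w] measurable_space[OF Ym w] Hhat_carrier by auto
    then have "Hhat (?Z w) - H w \<in> carrier_mat ?n K" by auto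
    then show "(frobenius_norm (Hhat (Y w) - H w))\<^sup>2 = (\<Sum>i<?n. \<Sum>k<K. (cmod (?g i k (?Z w) - H w $$ (i, k)))\<^sup>2)"
      unfolding model[OF w] by (subst frobenius_norm_squared) (use Hw hat in \<open>auto intro!: sum.cong\<close>)
  qed simp
  also have "\<dots> = (\<Sum>i<?n. \<Sum>k<K. \<integral>w. (cmod (?g i k (?Z w) - H w $$ (i, k)))\<^sup>2 \<partial>P)"
    using mse(1) by (subst Bochner_Integration.integral_sum) (auto intro!: Bochner_Integration.integrable_sum Bochner_Integration.integral_sum sum.cong)
  also have "\<dots> \<ge> (\<Sum>i<?n. \<Sum>k<K. Re (C $$ (i, i)))"
    using mse(3) by (intro sum_mono) auto
  finally have "(\<integral>w. (frobenius_norm (Hhat (Y w) - H w))\<^sup>2 \<partial>P) \<ge> real K * (\<Sum>i<?n. Re (C $$ (i, i)))"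
    by (simp add: sum_distrib_left)
  \<comment> \<open>The complex order asks for equal imaginary parts. The left side is real, so the
    trace has to be real as well.\<close>
  moreover have "Im (C $$ (i, i)) = 0" if "i < ?n" for i
    using mse(2)[OF that \<open>K > 0\<close>] that \<open>K > 0\<close> by auto
  ultimately show ?thesis
    unfolding tr by (simp add: less_eq_complex_def)
qed

end
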